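(* Let $\Omega\subseteq\mathbf{R}^{n}$ be a non-empty connected open set and let $u\in\mathcal{D}'(\Omega)$. Suppose that for every $\varphi\in\mathcal{D}(\Omega)$ there exists $m(\varphi)\in\mathbf{N}$ such that $(D^{\alpha}u)(\varphi)=0$ for all multi-indices $\alpha$ satisfying $\left\Vert\alpha\right\Vert=m(\varphi)$. Then $u$ is a polynomial (in the distributional sense).
   Context: A multi-index is an ordered $n$-tuple $\alpha=(\alpha_1,\ldots,\alpha_n)$ of nonnegative integers, with order $\left\Vert\alpha\right\Vert:=\alpha_1+\cdots+\alpha_n$, and $D^{\alpha}:=\left(\frac{\partial}{\partial x_1}\right)^{\alpha_1}\cdots\left(\frac{\partial}{\partial x_n}\right)^{\alpha_n}$ (with $D^{\alpha}u:=u$ if $\left\Vert\alpha\right\Vert=0$); on distributions $D^\alpha$ is the usual distributional derivative. $\mathcal{D}(\Omega)$ is the space $C_0^\infty(\Omega)$ of complex-valued infinitely differentiable functions on $\Omega$ with compact support in $\Omega$, with its usual inductive limit topology (from the Fr\'echet spaces $\mathcal{D}_K$ of smooth functions supported in a compact set $K\subset\Omega$). $\mathcal{D}'(\Omega)$ is the space of distributions, i.e. continuous linear functionals on $\mathcal{D}(\Omega)$. A distribution $u\in\mathcal{D}'(\Omega)$ is a polynomial in the distributional sense if there is a polynomial $p$ in $n$ variables (with complex coefficients) such that $u(\varphi)=\int_\Omega p(x)\varphi(x)\,dx$ for all $\varphi\in\mathcal{D}(\Omega)$. *)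

theory Defs
  imports "HOL-Analysis.Analysis"
begin

definition partial_deriv :: "'n::finite \<Rightarrow> (real^'n \<Rightarrow> complex) \<Rightarrow> real^'n \<Rightarrow> complex" where
  "partial_deriv i f x = vector_derivative (\<lambda>t. f (x + t *\<^sub>R axis i 1)) (at 0)"

primrec Ck :: "nat \<Rightarrow> (real^'n::finite \<Rightarrow> complex) \<Rightarrow> bool" where
  "Ck 0 f \<longleftrightarrow> continuous_on UNIV f"
| "Ck (Suc k) f \<longleftrightarrow> continuous_on UNIV f \<and>
     (\<forall>i. (\<forall>x. (\<lambda>t. f (x + t *\<^sub>R axis i 1)) differentiable (at 0)) \<and> Ck k (partial_deriv i f))"

definition smooth :: "(real^'n::finite \<Rightarrow> complex) \<Rightarrow> bool" where
  "smooth f \<longleftrightarrow> (\<forall>k. Ck k f)"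

(* The index type 'n carries no order, so the coordinates x_1, ..., x_n are listed in a fixed
   but unspecified order.  On smooth functions the partial derivatives commute, so the choice
   does not affect the value of mderiv. *)
definition coords :: "'n::finite list" where
  "coords = (SOME xs. distinct xs \<and> set xs = UNIV)"

definition mi_order :: "('n::finite \<Rightarrow> nat) \<Rightarrow> nat" where
  "mi_order \<alpha> = (\<Sum>i\<in>UNIV. \<alpha> i)"

definition mderiv :: "('n::finite \<Rightarrow> nat) \<Rightarrow> (real^'n \<Rightarrow> complex) \<Rightarrow> real^'n \<Rightarrow> complex" where
  "mderiv \<alpha> f = foldr (\<lambda>i. partial_deriv i ^^ \<alpha> i) coords f"

definition support :: "(real^'n::finite \<Rightarrow> complex) \<Rightarrow> (real^'n) set" where
  "support f = closure {x. f x \<noteq> 0}"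

definition test_functions_on :: "(real^'n::finite) set \<Rightarrow> (real^'n \<Rightarrow> complex) set" where
  "test_functions_on K = {\<phi>. smooth \<phi> \<and> support \<phi> \<subseteq> K}"

(* A test function on \<Omega> is represented by its extension by zero to the whole space. *)
definition test_functions :: "(real^'n::finite) set \<Rightarrow> (real^'n \<Rightarrow> complex) set" where
  "test_functions \<Omega> = {\<phi>. smooth \<phi> \<and> compact (support \<phi>) \<and> support \<phi> \<subseteq> \<Omega>}"

(* The Frechet topology of the space of smooth functions supported in K: it is generated by the
   open balls of the seminorms sup |mderiv \<alpha> \<phi>|.  For compact K the supremum is attained, so
   it is < e iff all the values are < e. *)
definition test_topology_on :: "(real^'n::finite) set \<Rightarrow> (real^'n \<Rightarrow> complex) topology" where
  "test_topology_on K = topology_generated_by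
     {{\<psi> \<in> test_functions_on K. \<forall>x. norm (mderiv \<alpha> (\<lambda>y. \<psi> y - \<phi> y) x) < e} | \<alpha> \<phi> e.
        \<phi> \<in> test_functions_on K \<and> e > 0}"

definition convex_balanced :: "(real^'n::finite \<Rightarrow> complex) set \<Rightarrow> bool" where
  "convex_balanced W \<longleftrightarrow>
     (\<forall>\<phi>\<in>W. \<forall>\<psi>\<in>W. \<forall>t\<in>{0..1::real}. (\<lambda>x. of_real (1 - t) * \<phi> x + of_real t * \<psi> x) \<in> W) \<and>
     (\<forall>\<phi>\<in>W. \<forall>c::complex. norm c \<le> 1 \<longrightarrow> (\<lambda>x. c * \<phi> x) \<in> W)"

(* The locally convex inductive limit topology: generated by the translates of the convex balanced
   sets that intersect each test_functions_on K, with K a compact subset of \<Omega>, in an open set. *)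
definition test_topology :: "(real^'n::finite) set \<Rightarrow> (real^'n \<Rightarrow> complex) topology" where
  "test_topology \<Omega> = topology_generated_by
     {(\<lambda>\<psi> x. \<phi> x + \<psi> x) ` W | \<phi> W.
        \<phi> \<in> test_functions \<Omega> \<and> W \<subseteq> test_functions \<Omega> \<and> convex_balanced W \<and>
        (\<forall>K. compact K \<and> K \<subseteq> \<Omega> \<longrightarrow> openin (test_topology_on K) (W \<inter> test_functions_on K))}"

(* Functionals are total functions in HOL; only their values on test_functions \<Omega> matter,
   and these are the points of test_topology \<Omega> (lemma topspace_test_topology below). *)
definition distributions :: "(real^'n::finite) set \<Rightarrow> ((real^'n \<Rightarrow> complex) \<Rightarrow> complex) set" where
  "distributions \<Omega> = {u.
     (\<forall>\<phi>\<in>test_functions \<Omega>. \<forall>\<psi>\<in>test_functions \<Omega>. u (\<lambda>x. \<phi> x + \<psi> x) = u \<phi> + u \<psi>) \<and>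
     (\<forall>\<phi>\<in>test_functions \<Omega>. \<forall>c. u (\<lambda>x. c * \<phi> x) = c * u \<phi>) \<and>
     continuous_map (test_topology \<Omega>) euclidean u}"

definition distr_D ::
  "('n::finite \<Rightarrow> nat) \<Rightarrow> ((real^'n \<Rightarrow> complex) \<Rightarrow> complex) \<Rightarrow> (real^'n \<Rightarrow> complex) \<Rightarrow> complex" where
  "distr_D \<alpha> u \<phi> = (-1) ^ mi_order \<alpha> * u (mderiv \<alpha> \<phi>)"

definition complex_polynomial :: "(real^'n::finite \<Rightarrow> complex) \<Rightarrow> bool" where
  "complex_polynomial p \<longleftrightarrow> (\<exists>(A :: ('n \<Rightarrow> nat) set) c. finite A \<and>
     p = (\<lambda>x. \<Sum>\<alpha>\<in>A. c \<alpha> * of_real (\<Prod>i\<in>UNIV. x $ i ^ \<alpha> i)))"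

definition is_polynomial_distribution ::
  "(real^'n::finite) set \<Rightarrow> ((real^'n \<Rightarrow> complex) \<Rightarrow> complex) \<Rightarrow> bool" where
  "is_polynomial_distribution \<Omega> u \<longleftrightarrow> (\<exists>p. complex_polynomial p \<and>
     (\<forall>\<phi>\<in>test_functions \<Omega>. u \<phi> = (LINT x:\<Omega>|lborel. p x * \<phi> x)))"

lemma coords: "distinct (coords :: 'n::finite list) \<and> set (coords :: 'n list) = UNIV"
proof -
  obtain xs :: "'n list" where "set xs = UNIV" "distinct xs"
    using finite_distinct_list[OF finite[of "UNIV :: 'n set"]] by blast
  then have "\<exists>xs :: 'n list. distinct xs \<and> set xs = UNIV"
    by (intro exI[of _ xs] conjI)
  then show ?thesis
    unfolding coords_def by (rule someI_ex)
qed

lemma partial_deriv_0: "partial_deriv i (\<lambda>_. 0) = (\<lambda>_. 0)"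
  by (auto simp: partial_deriv_def)

lemma mderiv_0:
  fixes \<alpha> :: "'n::finite \<Rightarrow> nat"
  shows "mderiv \<alpha> (\<lambda>_. 0) = (\<lambda>_. 0)"
proof -
  have *: "(partial_deriv i ^^ k) (\<lambda>_. 0) = (\<lambda>_. 0)" for i :: 'n and k
    by (induction k) (auto simp: partial_deriv_0)
  have "foldr (\<lambda>i. partial_deriv i ^^ \<alpha> i) xs (\<lambda>_. 0) = (\<lambda>_. 0)" for xs
    by (induction xs) (auto simp: *)
  then show ?thesis by (simp add: mderiv_def)
qed

lemma Ck_add: "Ck k f \<Longrightarrow> Ck k g \<Longrightarrow> Ck k (\<lambda>x. f x + g x)"
proof (induction k arbitrary: f g)
  case 0
  then show ?case by (simp add: continuous_on_add)
next
  case (Suc k)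
  have "partial_deriv i (\<lambda>x. f x + g x) = (\<lambda>x. partial_deriv i f x + partial_deriv i g x)" for i
    unfolding partial_deriv_def using Suc.prems
    by (intro ext vector_derivative_add_at) simp_all
  with Suc show ?case by (simp add: continuous_on_add)
qed

lemma Ck_cmult: "Ck k f \<Longrightarrow> Ck k (\<lambda>x. c * f x)"
proof (induction k arbitrary: f)
  case 0
  then show ?case by (simp add: continuous_on_mult_left)
next
  case (Suc k)
  have "partial_deriv i (\<lambda>x. c * f x) = (\<lambda>x. c * partial_deriv i f x)" for i
    unfolding partial_deriv_def using Suc.prems
    by (intro ext) simp
  with Suc show ?case by (simp add: continuous_on_mult_left)
qed

lemma Ck_0: "Ck k (\<lambda>_. 0)"
  by (induction k) (auto simp: partial_deriv_0)

lemma test_functions_0: "(\<lambda>_. 0) \<in> test_functions \<Omega>"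
  by (simp add: test_functions_def smooth_def Ck_0 support_def)

lemma support_subset_imp_compact:
  "support f \<subseteq> K \<Longrightarrow> compact K \<Longrightarrow> compact (support f)"
  using compact_Int_closed[of K "support f"] by (simp add: support_def inf.absorb2)

lemma test_functions_add:
  assumes "\<phi> \<in> test_functions \<Omega>" "\<psi> \<in> test_functions \<Omega>"
  shows "(\<lambda>x. \<phi> x + \<psi> x) \<in> test_functions \<Omega>"
proof -
  have "support (\<lambda>x. \<phi> x + \<psi> x) \<subseteq> closure ({x. \<phi> x \<noteq> 0} \<union> {x. \<psi> x \<noteq> 0})"
    unfolding support_def by (intro closure_mono) auto
  then have *: "support (\<lambda>x. \<phi> x + \<psi> x) \<subseteq> support \<phi> \<union> support \<psi>"
    by (simp add: support_def)
  then have "compact (support (\<lambda>x. \<phi> x + \<psi> x))"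
    using assms by (intro support_subset_imp_compact[OF *] compact_Un) (auto simp: test_functions_def)
  with * assms show ?thesis
    by (auto simp: test_functions_def smooth_def intro: Ck_add)
qed

lemma test_functions_cmult:
  assumes "\<phi> \<in> test_functions \<Omega>"
  shows "(\<lambda>x. c * \<phi> x) \<in> test_functions \<Omega>"
proof -
  have *: "support (\<lambda>x. c * \<phi> x) \<subseteq> support \<phi>"
    unfolding support_def by (intro closure_mono) auto
  then have "compact (support (\<lambda>x. c * \<phi> x))"
    using assms by (intro support_subset_imp_compact[OF *]) (auto simp: test_functions_def)
  with * assms show ?thesis
    by (auto simp: test_functions_def smooth_def intro: Ck_cmult)
qed

lemma topspace_test_topology_on:
  fixes K :: "(real^'n::finite) set"
  shows "topspace (test_topology_on K) = test_functions_on K"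
proof
  show "topspace (test_topology_on K) \<subseteq> test_functions_on K"
    by (auto simp: test_topology_on_def)
  show "test_functions_on K \<subseteq> topspace (test_topology_on K)"
  proof
    fix \<phi> :: "real^'n \<Rightarrow> complex"
    assume \<phi>: "\<phi> \<in> test_functions_on K"
    let ?B = "{\<psi> \<in> test_functions_on K. \<forall>x. norm (mderiv (\<lambda>_. 0) (\<lambda>y. \<psi> y - \<phi> y) x) < 1}"
    have "openin (test_topology_on K) ?B"
      unfolding test_topology_on_def
      by (intro topology_generated_by_Basis CollectI exI[of _ "\<lambda>_. 0"] exI[of _ \<phi>] exI[of _ 1])
         (simp add: \<phi>)
    moreover have "\<phi> \<in> ?B"
      using \<phi> by (simp add: mderiv_0)
    ultimately show "\<phi> \<in> topspace (test_topology_on K)"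
      by (rule openin_subset[THEN subsetD])
  qed
qed

lemma topspace_test_topology: "topspace (test_topology \<Omega>) = test_functions \<Omega>"
proof
  show "topspace (test_topology \<Omega>) \<subseteq> test_functions \<Omega>"
    by (auto simp: test_topology_def intro: test_functions_add)
  have cb: "convex_balanced (test_functions \<Omega>)"
    unfolding convex_balanced_def by (intro conjI ballI allI impI test_functions_add test_functions_cmult)
  have "openin (test_topology_on K) (test_functions \<Omega> \<inter> test_functions_on K)"
    if "compact K" "K \<subseteq> \<Omega>" for K
  proof -
    have "test_functions_on K \<subseteq> test_functions \<Omega>"
      using that support_subset_imp_compact[of _ K]
      unfolding test_functions_def test_functions_on_def by blast
    then have "test_functions \<Omega> \<inter> test_functions_on K = topspace (test_topology_on K)"
      by (simp add: topspace_test_topology_on Int_absorb1)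
    then show ?thesis by simp
  qed
  then have "openin (test_topology \<Omega>) ((\<lambda>\<psi> x. 0 + \<psi> x) ` test_functions \<Omega>)"
    unfolding test_topology_def
    by (intro topology_generated_by_Basis CollectI exI[of _ "\<lambda>_. 0"] exI[of _ "test_functions \<Omega>"] conjI allI impI)
       (simp_all add: cb test_functions_0)
  from openin_subset[OF this] show "test_functions \<Omega> \<subseteq> topspace (test_topology \<Omega>)"
    by simp
qed

end

theory Submission
  imports Defs "HOL-Complex_Analysis.Conformal_Mappings"
begin

text \<open>For each box in \<open>\<Omega>\<close> one order \<open>m\<close> serves all test functions supported in it: otherwise a power
  series in a complex parameter, with small multiples of counterexamples to all orders as coefficients,
  would take a value for which no order works. Thus every \<open>m\<close>-th derivative of \<open>u\<close> along a single
  coordinate vanishes on the box. Peeling off polynomial primitives reduces this to a functional with vanishing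
  gradient; such a functional is a multiple of the integral, since every test function is, modulo
  derivatives of test functions, a multiple of a fixed product bump. The local polynomials
  then agree by connectedness.\<close>

section \<open>Smooth functions\<close>

text \<open>The obstacle is that vanishing at order \<open>m\<close> on a test function does not
  pass to order \<open>m + 1\<close> on the same function, whose derivatives are other test
  functions. Orders therefore cannot simply be increased, and a contradiction needs one test
  function that defeats every order at once. A complex parameter provides it, since each order
  excludes only countably many parameter values. Only pure derivatives
  \<open>wderiv (replicate m i)\<close> are extracted from the hypothesis. They suffice because
  their vanishing confines the exponents to the finite set \<open>below (\<lambda>_. m)\<close>, and
  working one coordinate at a time makes every primitive a one-dimensional integral. Boxes fit this:
  a line in direction \<open>i\<close> either misses the box or meets it in the full interval of
  coordinate \<open>i\<close>, so integrating along it and multiplying by a one-dimensional bump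
  does not leave the box. Continuity of \<open>u\<close> enters through sequences: it turns a
  convergent series of test functions into a power series of values.\<close>

definition has_pd :: "'n::finite \<Rightarrow> (real^'n \<Rightarrow> complex) \<Rightarrow> (real^'n \<Rightarrow> complex) \<Rightarrow> bool" where
  "has_pd i f g \<longleftrightarrow> (\<forall>x. ((\<lambda>t. f (x + t *\<^sub>R axis i 1)) has_vector_derivative g x) (at 0))"

text \<open>\<open>partial_deriv\<close> is a total operator whose value alone does not show that a
  derivative exists. The calculus is therefore done with the relation \<open>has_pd\<close> and
  carried back to the operator here.\<close>

lemma has_pd_partial: "has_pd i f g \<Longrightarrow> partial_deriv i f = g"
  unfolding has_pd_def partial_deriv_def by (auto intro!: ext vector_derivative_at)

lemma has_pd_iff:
  "has_pd i f (partial_deriv i f) \<longleftrightarrow> (\<forall>x. (\<lambda>t. f (x + t *\<^sub>R axis i 1)) differentiable (at 0))"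
  unfolding has_pd_def partial_deriv_def vector_derivative_works by simp

text \<open>\<open>has_pd\<close> speaks of the parameter value 0 only, but at every base point;
  moving the base point along the line reaches every other parameter.\<close>

lemma has_pd_at:
  assumes "has_pd i f g"
  shows "((\<lambda>t. f (x + t *\<^sub>R axis i 1)) has_vector_derivative g (x + s *\<^sub>R axis i 1)) (at s)"
proof -
  have "((\<lambda>t. f ((x + s *\<^sub>R axis i 1) + t *\<^sub>R axis i 1)) has_vector_derivative g (x + s *\<^sub>R axis i 1)) (at (s - s))"
    using assms by (simp add: has_pd_def)
  then have "((\<lambda>t. f ((x + s *\<^sub>R axis i 1) + t *\<^sub>R axis i 1)) \<circ> (\<lambda>t. t - s) has_vector_derivative 1 *\<^sub>R g (x + s *\<^sub>R axis i 1)) (at s)"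
    by (intro vector_diff_chain_at) (auto intro!: derivative_eq_intros)
  then show ?thesis by (simp add: o_def algebra_simps)
qed

lemma has_pd_const: "has_pd i (\<lambda>_. c) (\<lambda>_. 0)"
  by (simp add: has_pd_def)

lemma has_pd_add: "has_pd i f f' \<Longrightarrow> has_pd i g g' \<Longrightarrow> has_pd i (\<lambda>x. f x + g x) (\<lambda>x. f' x + g' x)"
  by (auto simp: has_pd_def intro!: has_vector_derivative_add)

lemma has_pd_diff: "has_pd i f f' \<Longrightarrow> has_pd i g g' \<Longrightarrow> has_pd i (\<lambda>x. f x - g x) (\<lambda>x. f' x - g' x)"
  by (auto simp: has_pd_def intro!: has_vector_derivative_diff)

lemma has_pd_mult:
  "has_pd i f f' \<Longrightarrow> has_pd i g g' \<Longrightarrow> has_pd i (\<lambda>x. f x * g x) (\<lambda>x. f x * g' x + f' x * g x)"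
  unfolding has_pd_def using has_vector_derivative_mult by fastforce

lemma has_pd_cmult: "has_pd i f f' \<Longrightarrow> has_pd i (\<lambda>x. c * f x) (\<lambda>x. c * f' x)"
  using has_pd_mult[OF has_pd_const[of i c]] by fastforce

lemma has_pd_cnj: "has_pd i f f' \<Longrightarrow> has_pd i (\<lambda>x. cnj (f x)) (\<lambda>x. cnj (f' x))"
  unfolding has_pd_def using has_vector_derivative_cnj by blast

lemma has_pd_sum:
  "(\<And>a. a \<in> A \<Longrightarrow> has_pd i (f a) (f' a)) \<Longrightarrow> has_pd i (\<lambda>x. \<Sum>a\<in>A. f a x) (\<lambda>x. \<Sum>a\<in>A. f' a x)"
  unfolding has_pd_def by (auto intro!: has_vector_derivative_sum)

lemma has_pd_cong_open:
  fixes f g :: "real^'n::finite \<Rightarrow> complex"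
  assumes "open U" "x \<in> U" "\<And>y. y \<in> U \<Longrightarrow> f y = g y"
    and "((\<lambda>t. g (x + t *\<^sub>R axis i 1)) has_vector_derivative D) (at 0)"
  shows "((\<lambda>t. f (x + t *\<^sub>R axis i 1)) has_vector_derivative D) (at 0)"
proof -
  let ?V = "(\<lambda>t::real. x + t *\<^sub>R axis i 1) -` U"
  have "continuous_on UNIV (\<lambda>t::real. x + t *\<^sub>R axis i 1)"
    by (intro continuous_on_add continuous_on_scaleR continuous_on_const continuous_on_id)
  then have "open ?V" using assms(1) open_vimage by blast
  moreover have "0 \<in> ?V" using assms(2) by simp
  ultimately show ?thesis
    by (rule has_vector_derivative_transform_within_open[OF assms(4)]) (simp add: assms(3))
qed

lemma Ck_Suc_iff:
  "Ck (Suc k) f \<longleftrightarrow> continuous_on UNIV f \<and> (\<forall>i. has_pd i f (partial_deriv i f) \<and> Ck k (partial_deriv i f))"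
  by (auto simp: has_pd_iff)

declare Ck.simps(2) [simp del]

lemma smooth_continuous: "smooth f \<Longrightarrow> continuous_on S f"
  unfolding smooth_def by (metis Ck.simps(1) continuous_on_subset subset_UNIV)

lemma smooth_has_pd: "smooth f \<Longrightarrow> has_pd i f (partial_deriv i f)"
  unfolding smooth_def by (metis Ck_Suc_iff)

lemma smooth_partial: "smooth f \<Longrightarrow> smooth (partial_deriv i f)"
  unfolding smooth_def by (metis Ck_Suc_iff)

text \<open>A class of continuous functions closed under partial derivatives consists of smooth
  functions, by induction on the order. The alternative \<open>smooth g\<close> lets a derivative
  leave the class for a function already known to be smooth.\<close>

lemma smooth_coinduct [consumes 1, case_names continuous derivative]:
  assumes "P f"
    and c: "\<And>f. P f \<Longrightarrow> continuous_on UNIV f"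
    and d: "\<And>f i. P f \<Longrightarrow> \<exists>g. has_pd i f g \<and> (P g \<or> smooth g)"
  shows "smooth f"
proof -
  have "Ck k g" if "P g \<or> smooth g" for k g
    using that
  proof (induction k arbitrary: g)
    case 0
    then show ?case using c smooth_continuous by auto
  next
    case (Suc k)
    show ?case unfolding Ck_Suc_iff
    proof (intro conjI allI)
      show "continuous_on UNIV g" using Suc c smooth_continuous by auto
      fix i
      obtain g' where "has_pd i g g'" "P g' \<or> smooth g'"
        using Suc.prems d smooth_has_pd smooth_partial by blast
      then show "has_pd i g (partial_deriv i g)" "Ck k (partial_deriv i g)"
        using Suc.IH has_pd_partial by auto
    qed
  qed
  then show ?thesis using assms(1) by (auto simp: smooth_def)
qed

lemma Ck_Suc_imp: "Ck (Suc k) f \<Longrightarrow> Ck k f"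
proof (induction k arbitrary: f)
  case (Suc k)
  then show ?case by (metis Ck_Suc_iff)
qed (simp add: Ck_Suc_iff)

text \<open>The derivative of a product is a sum of products, so products alone are not a class to
  which \<open>smooth_coinduct\<close> applies. Induction on \<open>k\<close> works, with
  \<open>Ck_Suc_imp\<close> lowering the order of the factor left undifferentiated.\<close>

lemma Ck_mult: "Ck k f \<Longrightarrow> Ck k g \<Longrightarrow> Ck k (\<lambda>x. f x * g x)"
proof (induction k arbitrary: f g)
  case 0
  then show ?case by (simp add: continuous_on_mult)
next
  case (Suc k)
  have *: "has_pd i (\<lambda>x. f x * g x) (\<lambda>x. f x * partial_deriv i g x + partial_deriv i f x * g x)" for i
    using Suc.prems by (intro has_pd_mult) (auto simp: Ck_Suc_iff)
  show ?case unfolding Ck_Suc_iff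
  proof (intro conjI allI)
    show "continuous_on UNIV (\<lambda>x. f x * g x)"
      using Suc.prems by (auto simp: Ck_Suc_iff intro!: continuous_on_mult)
    fix i
    show "has_pd i (\<lambda>x. f x * g x) (partial_deriv i (\<lambda>x. f x * g x))"
      using * has_pd_partial by metis
    have "Ck k (\<lambda>x. f x * partial_deriv i g x + partial_deriv i f x * g x)"
      using Suc Ck_Suc_imp by (intro Ck_add Suc.IH) (auto simp: Ck_Suc_iff)
    then show "Ck k (partial_deriv i (\<lambda>x. f x * g x))"
      using * has_pd_partial by metis
  qed
qed

lemma smooth_mult: "smooth f \<Longrightarrow> smooth g \<Longrightarrow> smooth (\<lambda>x. f x * g x)"
  by (simp add: smooth_def Ck_mult)

lemma smooth_add: "smooth f \<Longrightarrow> smooth g \<Longrightarrow> smooth (\<lambda>x. f x + g x)"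
  by (simp add: smooth_def Ck_add)

lemma smooth_const: "smooth (\<lambda>_. c)"
  by (rule smooth_coinduct[where P = "\<lambda>f. \<exists>c. f = (\<lambda>_. c)"]) (auto intro!: exI has_pd_const)

lemma smooth_cmult: "smooth f \<Longrightarrow> smooth (\<lambda>x. c * f x)"
  by (simp add: smooth_mult smooth_const)

lemma smooth_diff: "smooth f \<Longrightarrow> smooth g \<Longrightarrow> smooth (\<lambda>x. f x - g x)"
  using smooth_add[OF _ smooth_cmult[of g "-1"], of f] by simp

lemma smooth_sum: "(\<And>a. a \<in> A \<Longrightarrow> smooth (f a)) \<Longrightarrow> smooth (\<lambda>x. \<Sum>a\<in>A. f a x)"
  by (induction A rule: infinite_finite_induct) (auto intro!: smooth_const smooth_add)

lemma smooth_prod: "(\<And>a. a \<in> A \<Longrightarrow> smooth (f a)) \<Longrightarrow> smooth (\<lambda>x. \<Prod>a\<in>A. f a x)"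
  by (induction A rule: infinite_finite_induct) (auto intro!: smooth_const smooth_mult)

lemma smooth_cnj: "smooth f \<Longrightarrow> smooth (\<lambda>x. cnj (f x))"
proof -
  assume "smooth f"
  then have "\<exists>g. smooth g \<and> (\<lambda>x. cnj (f x)) = (\<lambda>x. cnj (g x))" by blast
  then show ?thesis
  proof (rule smooth_coinduct[where P = "\<lambda>h. \<exists>g. smooth g \<and> h = (\<lambda>x. cnj (g x))"])
    fix f :: "real^'n \<Rightarrow> complex" assume "\<exists>g. smooth g \<and> f = (\<lambda>x. cnj (g x))"
    then obtain g where g: "smooth g" "f = (\<lambda>x. cnj (g x))" by blast
    then show "continuous_on UNIV f" by (metis continuous_on_cnj smooth_continuous)
    fix i
    show "\<exists>h. has_pd i f h \<and> ((\<exists>g. smooth g \<and> h = (\<lambda>x. cnj (g x))) \<or> smooth h)"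
      using has_pd_cnj[OF smooth_has_pd[OF g(1)], of i] smooth_partial[OF g(1)] g by blast
  qed
qed

text \<open>The derivative of the inverse is a product of a smooth function and two copies of the
  inverse itself, so membership in \<open>Ck k\<close> lifts to \<open>Ck (Suc k)\<close>.\<close>

lemma smooth_inverse:
  assumes "smooth f" "\<And>x. f x \<noteq> 0"
  shows "smooth (\<lambda>x. inverse (f x))"
proof -
  have pd: "has_pd i (\<lambda>x. inverse (f x)) (\<lambda>x. - 1 * (partial_deriv i f x * (inverse (f x) * inverse (f x))))" for i
  proof (unfold has_pd_def, rule allI)
    fix x
    have "((inverse \<circ> (\<lambda>t. f (x + t *\<^sub>R axis i 1))) has_vector_derivative
       (partial_deriv i f x * (- (inverse (f x) ^ 2)))) (at 0)"
      using smooth_has_pd[OF assms(1), of i] assms(2)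
      by (intro field_vector_diff_chain_at) (auto simp: has_pd_def power2_eq_square intro!: derivative_eq_intros)
    then show "((\<lambda>t. inverse (f (x + t *\<^sub>R axis i 1))) has_vector_derivative
       - 1 * (partial_deriv i f x * (inverse (f x) * inverse (f x)))) (at 0)"
      by (simp add: o_def power2_eq_square)
  qed
  have "Ck k (\<lambda>x. inverse (f x))" for k
  proof (induction k)
    case 0
    then show ?case using assms smooth_continuous by (auto intro!: continuous_intros)
  next
    case (Suc k)
    have "Ck k (\<lambda>x. - 1 * (partial_deriv i f x * (inverse (f x) * inverse (f x))))" for i
      using smooth_partial[OF assms(1), of i] by (intro Ck_cmult Ck_mult Suc) (auto simp: smooth_def)
    moreover have "continuous_on UNIV (\<lambda>x. inverse (f x))"
      using assms smooth_continuous by (auto intro!: continuous_intros)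
    ultimately show ?case unfolding Ck_Suc_iff has_pd_partial[OF pd] using pd by blast
  qed
  then show ?thesis by (simp add: smooth_def)
qed

text \<open>Serves to glue: a function defined by cases is smooth once each point has a
  neighbourhood on which a single smooth formula holds.\<close>

lemma smooth_local:
  assumes "\<And>x. \<exists>U g. open U \<and> x \<in> U \<and> smooth g \<and> (\<forall>y\<in>U. f y = g y)"
  shows "smooth f"
proof -
  let ?P = "\<lambda>f :: real^'n \<Rightarrow> complex. \<forall>x. \<exists>U g. open U \<and> x \<in> U \<and> smooth g \<and> (\<forall>y\<in>U. f y = g y)"
  have "?P f" using assms by blast
  then show ?thesis
  proof (rule smooth_coinduct[where P = ?P])
    fix f assume f: "?P f"
    show "continuous_on UNIV f"
    proof (clarsimp simp: continuous_on_eq_continuous_at)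
      fix x
      obtain U g where U: "open U" "x \<in> U" "smooth g" "\<forall>y\<in>U. f y = g y" using f by blast
      then have "continuous (at x) g"
        using smooth_continuous[of g UNIV] by (simp add: continuous_on_eq_continuous_at)
      then show "isCont f x"
        using U by (metis continuous_on_cong continuous_on_eq_continuous_at smooth_continuous)
    qed
    fix i
    have pd: "\<exists>U g. open U \<and> x \<in> U \<and> smooth g \<and> (\<forall>y\<in>U. f y = g y) \<and> (\<forall>y\<in>U. 
      ((\<lambda>t. f (y + t *\<^sub>R axis i 1)) has_vector_derivative partial_deriv i g y) (at 0))" for x
    proof -
      obtain U g where U: "open U" "x \<in> U" "smooth g" "\<forall>y\<in>U. f y = g y" using f by blast
      have "((\<lambda>t. f (y + t *\<^sub>R axis i 1)) has_vector_derivative partial_deriv i g y) (at 0)" if "y \<in> U" for y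
        using smooth_has_pd[OF U(3), of i] U that
        by (intro has_pd_cong_open[OF U(1), of y f g]) (auto simp: has_pd_def)
      then show ?thesis using U by blast
    qed
    have "has_pd i f (partial_deriv i f)"
      unfolding has_pd_iff
    proof
      fix x
      show "(\<lambda>t. f (x + t *\<^sub>R axis i 1)) differentiable (at 0)"
        using pd[of x] differentiableI_vector by blast
    qed
    moreover have "?P (partial_deriv i f)"
    proof
      fix x
      obtain U g where U: "open U" "x \<in> U" "smooth g" "\<And>y. y \<in> U \<Longrightarrow>
        ((\<lambda>t. f (y + t *\<^sub>R axis i 1)) has_vector_derivative partial_deriv i g y) (at 0)"
        using pd[of x] by blast
      have "partial_deriv i f y = partial_deriv i g y" if "y \<in> U" for y
        using vector_derivative_at[OF U(4)[OF that]] by (simp add: partial_deriv_def[of i f])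
      then show "\<exists>U g. open U \<and> x \<in> U \<and> smooth g \<and> (\<forall>y\<in>U. partial_deriv i f y = g y)"
        using U smooth_partial by blast
    qed
    ultimately show "\<exists>g. has_pd i f g \<and> (?P g \<or> smooth g)" by blast
  qed
qed

section \<open>Smooth functions of a single coordinate\<close>

lemma continuous_pullback_coord: "continuous_on UNIV (\<lambda>x::real^'n. x $ i)"
  by (intro continuous_intros)

text \<open>The sequence \<open>G\<close> lists a real function together with all its derivatives.
  Along coordinate \<open>i\<close> a derivative moves one step in the sequence, along any other
  coordinate it vanishes.\<close>

lemma smooth_of_coord:
  fixes i :: "'n::finite" and G :: "nat \<Rightarrow> real \<Rightarrow> real"
  assumes "\<And>k t. (G k has_real_derivative G (Suc k) t) (at t)"
  shows "smooth (\<lambda>x. of_real (G 0 (x $ i)))"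
proof -
  have "\<exists>k. (\<lambda>x::real^'n. complex_of_real (G 0 (x $ i))) = (\<lambda>x. of_real (G k (x $ i)))" by blast
  then show ?thesis
  proof (rule smooth_coinduct[where P = "\<lambda>h. \<exists>k. h = (\<lambda>x. of_real (G k (x $ i)))"])
    fix h :: "real^'n \<Rightarrow> complex"
    assume "\<exists>k. h = (\<lambda>x. complex_of_real (G k (x $ i)))"
    then obtain k where h: "h = (\<lambda>x. complex_of_real (G k (x $ i)))" by blast
    have "continuous_on UNIV (G k)"
      using assms DERIV_continuous_on by blast
    then show "continuous_on UNIV h"
      unfolding h using continuous_on_compose2[OF _ continuous_pullback_coord[of i], of UNIV "G k"]
      by (intro continuous_on_of_real) simp
    fix j
    show "\<exists>g. has_pd j h g \<and> ((\<exists>k. g = (\<lambda>x. complex_of_real (G k (x $ i)))) \<or> smooth g)"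
    proof (cases "j = i")
      case True
      have "has_pd j h (\<lambda>x. of_real (G (Suc k) (x $ i)))"
      proof (unfold has_pd_def, rule allI)
        fix x :: "real^'n"
        have "((\<lambda>t. G k (x $ i + t)) has_real_derivative G (Suc k) (x $ i)) (at 0)"
          using assms[of k "x $ i"] DERIV_shift[of "G k" _ 0 "x $ i"] by (simp add: add.commute)
        then have "((\<lambda>t. complex_of_real (G k (x $ i + t))) has_vector_derivative of_real (G (Suc k) (x $ i))) (at 0)"
          by (intro has_vector_derivative_of_real) (simp add: has_real_derivative_iff_has_vector_derivative)
        then show "((\<lambda>t. h (x + t *\<^sub>R axis j 1)) has_vector_derivative of_real (G (Suc k) (x $ i))) (at 0)"
          by (simp add: h True axis_def)
      qed
      then show ?thesis by blast
    next
      case False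
      then have "has_pd j h (\<lambda>_. 0)"
        by (simp add: has_pd_def h axis_def)
      then show ?thesis using smooth_const by blast
    qed
  qed
qed

section \<open>Bump functions and test functions\<close>

text \<open>For \<open>p = 1\<close> this is the classical flat function exp(-1/t). The polynomial
  factor in 1/t makes the family closed under differentiation.\<close>

definition flat :: "real poly \<Rightarrow> real \<Rightarrow> real" where
  "flat p t = (if t > 0 then poly p (1 / t) * exp (- (1 / t)) else 0)"

lemma poly_times_exp_minus_tendsto_0: "((\<lambda>y::real. poly p y * exp (- y)) \<longlongrightarrow> 0) at_top"
proof -
  have "((\<lambda>y::real. \<Sum>i\<le>degree p. coeff p i * (y ^ i / exp y)) \<longlongrightarrow> (\<Sum>i\<le>degree p. coeff p i * 0)) at_top"
    by (intro tendsto_sum tendsto_mult_left tendsto_power_div_exp_0)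
  then show ?thesis
    by (simp add: poly_altdef sum_distrib_right exp_minus divide_inverse mult.assoc)
qed

text \<open>For positive \<open>t\<close> the chain rule produces the factor 1/t^2, hence
  \<open>[:0, 0, 1:]\<close>, and the difference \<open>p - pderiv p\<close>. At 0 the difference
  quotient from the right is again a polynomial in 1/h times exp(-1/h), which tends to 0; from the
  left it is 0.\<close>

lemma flat_has_derivative:
  "(flat p has_real_derivative flat ([:0, 0, 1:] * (p - pderiv p)) t) (at t)"
proof -
  consider "t > 0" | "t < 0" | "t = 0" by linarith
  then show ?thesis
  proof cases
    case 1
    have "((\<lambda>t. poly p (1 / t) * exp (- (1 / t))) has_real_derivative flat ([:0, 0, 1:] * (p - pderiv p)) t) (at t)"
      using 1 by (auto intro!: derivative_eq_intros DERIV_chain2[OF poly_DERIV]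
          simp: flat_def field_simps power2_eq_square)
    then show ?thesis
      using 1 by (elim has_field_derivative_transform_within_open[of _ _ _ "{0<..}"]) (auto simp: flat_def)
  next
    case 2
    have "((\<lambda>t. 0) has_real_derivative flat ([:0, 0, 1:] * (p - pderiv p)) t) (at t)"
      using 2 by (auto simp: flat_def)
    then show ?thesis
      using 2 by (elim has_field_derivative_transform_within_open[of _ _ _ "{..<0}"]) (auto simp: flat_def)
  next
    case 3
    have r: "((\<lambda>h. flat p h / h) \<longlongrightarrow> 0) (at_right 0)"
    proof (rule Lim_transform_eventually)
      show "((\<lambda>h. poly ([:0, 1:] * p) (inverse h) * exp (- inverse h)) \<longlongrightarrow> 0) (at_right (0::real))"
        by (rule filterlim_compose[OF poly_times_exp_minus_tendsto_0 filterlim_inverse_at_top_right])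
      show "\<forall>\<^sub>F h in at_right 0. poly ([:0, 1:] * p) (inverse h) * exp (- inverse h) = flat p h / h"
        using eventually_at_right_less[of 0]
        by eventually_elim (simp add: flat_def field_simps)
    qed
    have l: "((\<lambda>h. flat p h / h) \<longlongrightarrow> 0) (at_left 0)"
    proof (rule Lim_transform_eventually[OF tendsto_const])
      show "\<forall>\<^sub>F h in at_left 0. 0 = flat p h / h"
        by (auto simp: flat_def eventually_at intro!: exI[of _ 1])
    qed
    have "((\<lambda>h. flat p h / h) \<longlongrightarrow> 0) (at 0)"
      using l r by (rule filterlim_split_at)
    then show ?thesis
      using 3 by (simp add: has_field_derivative_iff flat_def)
  qed
qed

primrec flat_poly :: "nat \<Rightarrow> real poly" where
  "flat_poly 0 = 1"
| "flat_poly (Suc k) = [:0, 0, 1:] * (flat_poly k - pderiv (flat_poly k))"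

lemma smooth_flat_coord: "smooth (\<lambda>x::real^'n::finite. of_real (flat 1 (a * x $ i + b)))"
proof -
  have "((\<lambda>t. a ^ k * flat (flat_poly k) (a * t + b)) has_real_derivative
      a ^ Suc k * flat (flat_poly (Suc k)) (a * t + b)) (at t)" for k t
    by (auto intro!: derivative_eq_intros DERIV_chain2[OF flat_has_derivative])
  from smooth_of_coord[of "\<lambda>k t. a ^ k * flat (flat_poly k) (a * t + b)", OF this]
  show ?thesis by simp
qed

lemma flat_1_pos: "t > 0 \<Longrightarrow> flat 1 t > 0" and flat_1_0: "t \<le> 0 \<Longrightarrow> flat 1 t = 0"
  by (auto simp: flat_def)

lemma flat_1_nonneg: "flat 1 t \<ge> 0"
  by (auto simp: flat_def)

definition bump :: "real \<Rightarrow> real \<Rightarrow> real \<Rightarrow> real" where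
  "bump a b t = flat 1 (t - a) * flat 1 (b - t)"

lemma smooth_bump: "smooth (\<lambda>x::real^'n::finite. of_real (bump a b (x $ i)))"
  using smooth_mult[OF smooth_flat_coord[of 1 i "-a"] smooth_flat_coord[of "-1" i b]]
  by (simp add: bump_def)

lemma bump_nonneg: "bump a b t \<ge> 0"
  by (simp add: bump_def flat_1_nonneg)

lemma bump_pos: "a < t \<Longrightarrow> t < b \<Longrightarrow> bump a b t > 0"
  by (simp add: bump_def flat_1_pos)

lemma bump_0: "t \<le> a \<or> b \<le> t \<Longrightarrow> bump a b t = 0"
  by (auto simp: bump_def flat_1_0)

lemma continuous_on_bump: "continuous_on S (bump a b)"
proof -
  have "continuous_on UNIV (flat 1)"
    using flat_has_derivative[of 1] DERIV_continuous_on by blast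
  from continuous_on_compose2[OF this _ subset_UNIV] 
  have c: "continuous_on S f \<Longrightarrow> continuous_on S (\<lambda>x. flat 1 (f x))" for f :: "real \<Rightarrow> real" .
  show ?thesis
    unfolding bump_def[abs_def]
    by (intro continuous_on_mult c continuous_on_diff continuous_on_id continuous_on_const)
qed

definition box_bump :: "real^'n::finite \<Rightarrow> real^'n \<Rightarrow> real^'n \<Rightarrow> real" where
  "box_bump l r x = (\<Prod>i\<in>UNIV. bump (l $ i) (r $ i) (x $ i))"

lemma smooth_box_bump: "smooth (\<lambda>x. of_real (box_bump l r x))"
  by (simp add: box_bump_def smooth_prod smooth_bump)

lemma box_bump_nonneg: "box_bump l r x \<ge> 0"
  by (simp add: box_bump_def prod_nonneg bump_nonneg)

lemma box_bump_pos: "x \<in> box l r \<Longrightarrow> box_bump l r x > 0"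
  by (auto simp: box_bump_def mem_box_cart intro!: prod_pos bump_pos)

lemma box_bump_0: "x \<notin> box l r \<Longrightarrow> box_bump l r x = 0"
proof -
  assume "x \<notin> box l r"
  then obtain i where "x $ i \<le> l $ i \<or> r $ i \<le> x $ i" by (auto simp: mem_box_cart not_less)
  then have "bump (l $ i) (r $ i) (x $ i) = 0" by (rule bump_0)
  then show ?thesis unfolding box_bump_def by (intro prod_zero) auto
qed

lemma cutoff_exists:
  fixes x :: "real^'n::finite"
  assumes "d > 0"
  obtains \<psi> :: "real^'n \<Rightarrow> complex" where "smooth \<psi>"
    "\<And>y. (\<And>i. \<bar>y $ i - x $ i\<bar> < d) \<Longrightarrow> \<psi> y = 1"
    "\<And>y i. \<bar>y $ i - x $ i\<bar> \<ge> 2 * d \<Longrightarrow> \<psi> y = 0"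
proof -
  \<comment> \<open>The smooth step flat(t) / (flat(t) + flat(1 - t)) at
    \<open>t = a * y $ i + b\<close>: it is 0 for \<open>t \<le> 0\<close> and 1 for
    \<open>t \<ge> 1\<close>. The denominator is positive because \<open>t\<close> and
    \<open>1 - t\<close> cannot both be nonpositive.\<close>
  define s where "s = (\<lambda>a b i (y::real^'n). of_real (flat 1 (a * y $ i + b)) *
    inverse (of_real (flat 1 (a * y $ i + b)) + complex_of_real (flat 1 (- a * y $ i + (1 - b)))))"
  have nz: "flat 1 (a * t + b) + flat 1 (- a * t + (1 - b)) \<noteq> 0" for a b t
  proof -
    have "a * t + b > 0 \<or> - a * t + (1 - b) > 0" by simp argo
    then show ?thesis
      using flat_1_pos flat_1_nonneg by (metis add_nonneg_pos add_pos_nonneg less_irrefl)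
  qed
  have "smooth (s a b i)" for a b i
    unfolding s_def using nz
    by (intro smooth_mult smooth_inverse smooth_add smooth_flat_coord) (metis of_real_add of_real_eq_0_iff)
  moreover have "s a b i y = 1" if "a * y $ i + b \<ge> 1" for a b i y
    using that nz[of a "y $ i" b] flat_1_0[of "- a * y $ i + (1 - b)"] by (simp add: s_def)
  moreover have "s a b i y = 0" if "a * y $ i + b \<le> 0" for a b i y
    using that flat_1_0[of "a * y $ i + b"] by (simp add: s_def)
  ultimately have s: "smooth (s a b i)" "a * y $ i + b \<ge> 1 \<Longrightarrow> s a b i y = 1"
     "a * y $ i + b \<le> 0 \<Longrightarrow> s a b i y = 0" for a b i y by blast+
  show thesis
  \<comment> \<open>The two arguments are 2 + (y_i - x_i)/d and 2 - (y_i - x_i)/d. Both are at least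
    1 when y_i is within d of x_i, and one of them is at most 0 when the distance is at least
    2d.\<close>
  proof (rule that[of "\<lambda>y. \<Prod>i\<in>UNIV. s (1 / d) (2 - x $ i / d) i y * s (- 1 / d) (2 + x $ i / d) i y"])
    show "smooth (\<lambda>y. \<Prod>i\<in>UNIV. s (1 / d) (2 - x $ i / d) i y * s (- 1 / d) (2 + x $ i / d) i y)"
      by (intro smooth_prod smooth_mult s)
    show "(\<Prod>i\<in>UNIV. s (1 / d) (2 - x $ i / d) i y * s (- 1 / d) (2 + x $ i / d) i y) = 1"
      if "\<And>i. \<bar>y $ i - x $ i\<bar> < d" for y
    proof (intro prod.neutral ballI)
      fix i
      show "s (1 / d) (2 - x $ i / d) i y * s (- 1 / d) (2 + x $ i / d) i y = 1"
        using that[of i] assms less_imp_le[OF mult_pos_pos[of d "d + x $ i - y $ i"]]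
          less_imp_le[OF mult_pos_pos[of d "d - x $ i + y $ i"]]
        by (subst (1 2) s(2)) (auto simp: field_simps abs_less_iff)
    qed
    show "(\<Prod>i\<in>UNIV. s (1 / d) (2 - x $ i / d) i y * s (- 1 / d) (2 + x $ i / d) i y) = 0"
      if "\<bar>y $ i - x $ i\<bar> \<ge> 2 * d" for y i
    proof -
      have "(1 / d) * y $ i + (2 - x $ i / d) \<le> 0 \<or> (- 1 / d) * y $ i + (2 + x $ i / d) \<le> 0"
      proof -
        have "y $ i - x $ i \<ge> 2 * d \<or> y $ i - x $ i \<le> - 2 * d" using that by linarith
        then have "(y $ i - x $ i) / d \<ge> 2 \<or> (y $ i - x $ i) / d \<le> - 2"
          using assms by (simp add: pos_le_divide_eq pos_divide_le_eq)
        then show ?thesis by (auto simp: diff_divide_distrib)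
      qed
      then have "s (1 / d) (2 - x $ i / d) i y * s (- 1 / d) (2 + x $ i / d) i y = 0"
        using s(3) by auto
      then show ?thesis by (intro prod_zero) auto
    qed
  qed
qed

text \<open>Words of coordinates, with the head differentiated last, let one more derivative be put
  in front without regard to the coordinate order fixed in \<open>mderiv\<close>, whose values are
  the derivatives along particular words.\<close>

definition wderiv :: "'n::finite list \<Rightarrow> (real^'n \<Rightarrow> complex) \<Rightarrow> real^'n \<Rightarrow> complex" where
  "wderiv w f = foldr partial_deriv w f"

lemma wderiv_simps [simp]: "wderiv [] f = f" "wderiv (i # w) f = partial_deriv i (wderiv w f)"
  by (simp_all add: wderiv_def)

lemma wderiv_append: "wderiv (v @ w) f = wderiv v (wderiv w f)"
  by (simp add: wderiv_def)

lemma funpow_partial_deriv: "(partial_deriv i ^^ k) f = wderiv (replicate k i) f"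
  by (induction k) auto

lemma mderiv_word: "mderiv \<alpha> f = wderiv (concat (map (\<lambda>i. replicate (\<alpha> i) i) coords)) f"
proof -
  have "foldr (\<lambda>i. partial_deriv i ^^ \<alpha> i) xs f = wderiv (concat (map (\<lambda>i. replicate (\<alpha> i) i) xs)) f" for xs
    by (induction xs) (auto simp: wderiv_append funpow_partial_deriv)
  then show ?thesis by (simp add: mderiv_def)
qed

lemma mderiv_single: "mderiv (\<lambda>j. if j = i then m else 0) f = (partial_deriv i ^^ m) f"
proof -
  have "foldr (\<lambda>j. partial_deriv j ^^ (if j = i then m else 0)) xs f
      = (if i \<in> set xs then (partial_deriv i ^^ m) f else f)" if "distinct xs" for xs
    using that by (induction xs) auto
  then show ?thesis using coords[where 'n='a] by (simp add: mderiv_def)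
qed

lemma smooth_wderiv: "smooth f \<Longrightarrow> smooth (wderiv w f)"
  by (induction w) (auto intro: smooth_partial)

lemma partial_deriv_add: "smooth f \<Longrightarrow> smooth g \<Longrightarrow>
    partial_deriv i (\<lambda>x. f x + g x) = (\<lambda>x. partial_deriv i f x + partial_deriv i g x)"
  by (intro has_pd_partial has_pd_add smooth_has_pd)

lemma partial_deriv_diff: "smooth f \<Longrightarrow> smooth g \<Longrightarrow>
    partial_deriv i (\<lambda>x. f x - g x) = (\<lambda>x. partial_deriv i f x - partial_deriv i g x)"
  by (intro has_pd_partial has_pd_diff smooth_has_pd)

lemma partial_deriv_mult: "smooth f \<Longrightarrow> smooth g \<Longrightarrow>
    partial_deriv i (\<lambda>x. f x * g x) = (\<lambda>x. f x * partial_deriv i g x + partial_deriv i f x * g x)"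
  by (intro has_pd_partial has_pd_mult smooth_has_pd)

lemma partial_deriv_cmult: "smooth f \<Longrightarrow>
    partial_deriv i (\<lambda>x. c * f x) = (\<lambda>x. c * partial_deriv i f x)"
  by (intro has_pd_partial has_pd_cmult smooth_has_pd)

lemma wderiv_add: "smooth f \<Longrightarrow> smooth g \<Longrightarrow>
    wderiv w (\<lambda>x. f x + g x) = (\<lambda>x. wderiv w f x + wderiv w g x)"
  by (induction w) (auto simp: partial_deriv_add smooth_wderiv)

lemma wderiv_diff: "smooth f \<Longrightarrow> smooth g \<Longrightarrow>
    wderiv w (\<lambda>x. f x - g x) = (\<lambda>x. wderiv w f x - wderiv w g x)"
  by (induction w) (auto simp: partial_deriv_diff smooth_wderiv)

lemma wderiv_cmult: "smooth f \<Longrightarrow> wderiv w (\<lambda>x. c * f x) = (\<lambda>x. c * wderiv w f x)"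
  by (induction w) (auto simp: partial_deriv_cmult smooth_wderiv)

lemma wderiv_sum: "(\<And>a. a \<in> A \<Longrightarrow> smooth (f a)) \<Longrightarrow>
    wderiv w (\<lambda>x. \<Sum>a\<in>A. f a x) = (\<lambda>x. \<Sum>a\<in>A. wderiv w (f a) x)"
proof (induction A rule: infinite_finite_induct)
  case (insert a A)
  then show ?case by (simp add: wderiv_add smooth_sum)
next
qed (use wderiv_cmult[OF smooth_const[of 0], of w 0] in simp_all)

section \<open>Test functions supported in a fixed closed or compact set\<close>

lemma test_functions_on_iff:
  assumes "closed K"
  shows "f \<in> test_functions_on K \<longleftrightarrow> smooth f \<and> (\<forall>x. x \<notin> K \<longrightarrow> f x = 0)"
proof -
  have "support f \<subseteq> K \<longleftrightarrow> {x. f x \<noteq> 0} \<subseteq> K"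
    unfolding support_def using assms by (meson closure_minimal closure_subset subset_trans)
  then show ?thesis by (auto simp: test_functions_on_def)
qed

lemma test_functions_on_diff: "f \<in> test_functions_on K \<Longrightarrow> g \<in> test_functions_on K \<Longrightarrow> closed K \<Longrightarrow>
    (\<lambda>x. f x - g x) \<in> test_functions_on K"
  by (auto simp: test_functions_on_iff smooth_diff)

lemma test_functions_on_mult: "smooth f \<Longrightarrow> g \<in> test_functions_on K \<Longrightarrow> closed K \<Longrightarrow>
    (\<lambda>x. f x * g x) \<in> test_functions_on K"
  by (auto simp: test_functions_on_iff smooth_mult)

lemma test_functions_on_mono: "f \<in> test_functions_on K \<Longrightarrow> K \<subseteq> L \<Longrightarrow> f \<in> test_functions_on L"
  by (auto simp: test_functions_on_def)

lemma test_functions_on_subset: "compact K \<Longrightarrow> K \<subseteq> \<Omega> \<Longrightarrow> test_functions_on K \<subseteq> test_functions \<Omega>"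
  unfolding test_functions_on_def test_functions_def using support_subset_imp_compact by blast

lemma test_functions_on_partial:
  assumes "f \<in> test_functions_on K" "closed K"
  shows "partial_deriv i f \<in> test_functions_on K"
proof -
  have "partial_deriv i f x = 0" if "x \<notin> K" for x
  proof -
    have "((\<lambda>t. f (x + t *\<^sub>R axis i 1)) has_vector_derivative 0) (at 0)"
      using assms that by (intro has_pd_cong_open[of "- K" x f "\<lambda>_. 0"]) (auto simp: test_functions_on_iff)
    then show ?thesis by (simp add: partial_deriv_def vector_derivative_at)
  qed
  then show ?thesis using assms by (auto simp: test_functions_on_iff smooth_partial)
qed

lemma test_functions_on_wderiv:
  "f \<in> test_functions_on K \<Longrightarrow> closed K \<Longrightarrow> wderiv w f \<in> test_functions_on K"
  by (induction w) (auto intro: test_functions_on_partial)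

lemma test_functions_on_smooth: "f \<in> test_functions_on K \<Longrightarrow> smooth f"
  by (simp add: test_functions_on_def)

lemma test_functions_on_sum: "(\<And>a. a \<in> A \<Longrightarrow> f a \<in> test_functions_on K) \<Longrightarrow> closed K \<Longrightarrow>
    (\<lambda>x. \<Sum>a\<in>A. f a x) \<in> test_functions_on K"
  by (auto simp: test_functions_on_iff smooth_sum)

lemma test_functions_on_bounded:
  assumes "f \<in> test_functions_on K" "compact K"
  obtains B where "B > 0" "\<And>x. norm (f x) \<le> B"
proof -
  have "bounded (f ` K)"
    using test_functions_on_smooth[OF assms(1)] assms(2)
    by (intro compact_imp_bounded compact_continuous_image smooth_continuous)
  then obtain B where "B > 0" "\<forall>y\<in>f ` K. norm y \<le> B" using bounded_pos by blast
  then have "norm (f x) \<le> B" for x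
    using assms by (cases "x \<in> K") (auto simp: test_functions_on_iff compact_imp_closed)
  then show thesis using that \<open>B > 0\<close> by blast
qed

lemma test_functions_on_integrable:
  assumes "f \<in> test_functions_on K" "compact K"
  shows "integrable lborel f"
proof -
  have "integrable lborel (\<lambda>x. indicator K x *\<^sub>R f x)"
    using test_functions_on_smooth[OF assms(1)] assms(2)
    by (intro borel_integrable_compact smooth_continuous)
  moreover have "(\<lambda>x. indicator K x *\<^sub>R f x) = f"
    using assms by (auto simp: test_functions_on_iff compact_imp_closed indicator_def)
  ultimately show ?thesis by simp
qed

section \<open>Integration along a coordinate\<close>

lemma has_vector_derivative_quotient:
  assumes "(f has_vector_derivative D) (at 0)"
  shows "((\<lambda>t. (1 / t) *\<^sub>R (f t - f 0)) \<longlongrightarrow> D) (at 0)"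
proof -
  have "((\<lambda>h. norm (f (0 + h) - f 0 - h *\<^sub>R D) / norm h) \<longlongrightarrow> 0) (at 0)"
    using assms unfolding has_vector_derivative_def has_derivative_at by blast
  moreover have "\<forall>\<^sub>F h in at 0. norm (f (0 + h) - f 0 - h *\<^sub>R D) / norm h
      = norm ((1 / h) *\<^sub>R (f h - f 0) - D)"
  proof -
    have "norm (f (0 + h) - f 0 - h *\<^sub>R D) / norm h = norm ((1 / h) *\<^sub>R (f h - f 0) - D)"
      if "h \<noteq> 0" for h
    proof -
      have "(1 / h) *\<^sub>R (f h - f 0) - D = (1 / h) *\<^sub>R (f (0 + h) - f 0 - h *\<^sub>R D)"
        using that by (simp add: scaleR_diff_right)
      then show ?thesis by (simp only: norm_scaleR) simp
    qed
    then show ?thesis by (simp add: eventually_at_filter)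
  qed
  ultimately have "((\<lambda>h. norm ((1 / h) *\<^sub>R (f h - f 0) - D)) \<longlongrightarrow> 0) (at 0)"
    by (rule Lim_transform_eventually)
  then show ?thesis by (simp only: tendsto_norm_zero_iff LIM_zero_iff)
qed

text \<open>The mean value inequality on a coordinate line; it bounds all difference quotients of a
  test function by one constant, as dominated convergence requires.\<close>

lemma has_pd_norm_bound:
  assumes "has_pd i f g" "\<And>x. norm (g x) \<le> B"
  shows "norm (f (x + h *\<^sub>R axis i 1) - f x) \<le> B * \<bar>h\<bar>"
proof -
  have "norm (f (x + h *\<^sub>R axis i 1) - f (x + 0 *\<^sub>R axis i 1)) \<le> B * norm (h - 0)"
  proof (rule differentiable_bound[of UNIV "\<lambda>t. f (x + t *\<^sub>R axis i 1)" "\<lambda>s t. t *\<^sub>R g (x + s *\<^sub>R axis i 1)"])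
    fix s :: real
    show "((\<lambda>t. f (x + t *\<^sub>R axis i 1)) has_derivative (\<lambda>t. t *\<^sub>R g (x + s *\<^sub>R axis i 1))) (at s within UNIV)"
      using has_pd_at[OF assms(1)] by (simp add: has_vector_derivative_def)
    show "onorm (\<lambda>t. t *\<^sub>R g (x + s *\<^sub>R axis i 1)) \<le> B"
    proof (rule onorm_le)
      fix t :: real
      show "norm (t *\<^sub>R g (x + s *\<^sub>R axis i 1)) \<le> B * norm t"
        using mult_right_mono[OF assms(2), of "\<bar>t\<bar>"] by (simp add: mult.commute)
    qed
  qed auto
  then show ?thesis by simp
qed

lemma integral_translate:
  fixes f :: "'a::euclidean_space \<Rightarrow> 'b::{banach, second_countable_topology}"
  assumes "f \<in> borel_measurable borel"
  shows "(LINT x|lborel. f (x + c)) = integral\<^sup>L lborel f"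
  using integral_distr[of "(+) c" lborel borel f] assms
  by (simp add: lborel_distr_plus add.commute)

text \<open>By translation invariance every difference quotient of \<open>f\<close> has integral 0,
  and the quotients converge to the derivative under a common integrable bound.\<close>

lemma integral_partial_deriv:
  fixes f :: "real^'n::finite \<Rightarrow> complex"
  assumes f: "f \<in> test_functions_on K" and K: "compact K"
  shows "integral\<^sup>L lborel (partial_deriv i f) = 0"
proof -
  have cl: "closed K" and sm: "smooth f"
    by (rule compact_imp_closed[OF K], rule test_functions_on_smooth[OF f])
  obtain B where B: "B > 0" "\<And>x. norm (partial_deriv i f x) \<le> B"
    using test_functions_on_bounded[OF test_functions_on_partial[OF f cl] K] by blast
  obtain R where "\<forall>x\<in>K. norm x \<le> R"
    using compact_imp_bounded[OF K] unfolding bounded_iff by blast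
  then have R: "K \<subseteq> cball 0 R" by auto
  have meas: "f \<in> borel_measurable borel"
    using sm by (intro borel_measurable_continuous_onI smooth_continuous)
  have int: "integrable lborel f" by (rule test_functions_on_integrable[OF f K])
  define h where "h n = 1 / real (Suc n)" for n
  have h: "h n > 0" "h n \<le> 1" for n by (auto simp: h_def)
  have h0: "h \<longlonglongrightarrow> 0" unfolding h_def by (intro LIMSEQ_Suc lim_1_over_n)
  define g where "g n x = (1 / h n) *\<^sub>R (f (x + h n *\<^sub>R axis i 1) - f x)" for n x
  have translate_int: "integrable lborel (\<lambda>x. f (x + c))" for c
    using integrable_distr[of "(+) c" lborel borel f] int
    by (simp add: lborel_distr_plus add.commute)
  have "(\<lambda>n. integral\<^sup>L lborel (g n)) \<longlonglongrightarrow> integral\<^sup>L lborel (partial_deriv i f)"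
  \<comment> \<open>The radius \<open>R + 1\<close> leaves room for steps
    \<open>h n \<le> 1\<close>: outside that ball both \<open>x\<close> and the shifted point lie
    off \<open>K\<close>, so the quotient is 0.\<close>
  proof (rule integral_dominated_convergence[where w = "\<lambda>x. indicator (cball 0 (R + 1)) x *\<^sub>R B"])
    show "partial_deriv i f \<in> borel_measurable lborel"
      using smooth_partial[OF sm] by (simp add: borel_measurable_continuous_onI smooth_continuous)
    show "g n \<in> borel_measurable lborel" for n
      using meas unfolding g_def by measurable
    show "integrable lborel (\<lambda>x::real^'n. indicator (cball 0 (R + 1)) x *\<^sub>R B)"
      by (intro borel_integrable_compact) auto
    show "AE x in lborel. (\<lambda>n. g n x) \<longlonglongrightarrow> partial_deriv i f x"
    proof (rule AE_I2)
      fix x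
      have "((\<lambda>t. (1 / t) *\<^sub>R (f (x + t *\<^sub>R axis i 1) - f x)) \<longlongrightarrow> partial_deriv i f x) (at 0)"
        using has_vector_derivative_quotient smooth_has_pd[OF sm, of i] unfolding has_pd_def by fastforce
      moreover have "filterlim h (at 0) sequentially"
        using h0 h by (auto simp: filterlim_at intro!: always_eventually) (metis less_irrefl)
      ultimately show "(\<lambda>n. g n x) \<longlonglongrightarrow> partial_deriv i f x"
        unfolding g_def by (rule filterlim_compose)
    qed
    show "AE x in lborel. norm (g n x) \<le> indicator (cball 0 (R + 1)) x *\<^sub>R B" for n
    proof (rule AE_I2)
      fix x :: "real^'n"
      show "norm (g n x) \<le> indicator (cball 0 (R + 1)) x *\<^sub>R B"
      proof (cases "x \<in> cball 0 (R + 1)")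
        case True
        have "norm (f (x + h n *\<^sub>R axis i 1) - f x) \<le> B * \<bar>h n\<bar>"
          by (rule has_pd_norm_bound[OF smooth_has_pd[OF sm] B(2)])
        then have "norm (g n x) \<le> B"
          using h[of n] by (simp add: g_def pos_divide_le_eq del: scaleR_diff_right)
        then show ?thesis using True by simp
      next
        case False
        then have "norm x > R + 1" by simp
        moreover have "norm x \<le> norm (x + h n *\<^sub>R axis i 1) + norm (h n *\<^sub>R axis i (1::real) :: real^'n)"
          using norm_triangle_ineq4[of "x + h n *\<^sub>R axis i 1" "h n *\<^sub>R axis i 1"] by simp
        moreover have "norm (h n *\<^sub>R axis i (1::real) :: real^'n) \<le> 1" using h[of n] by simp
        ultimately have "x \<notin> K" "x + h n *\<^sub>R axis i 1 \<notin> K" using R by auto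
        then show ?thesis using f cl False by (simp add: g_def test_functions_on_iff)
      qed
    qed
  qed
  moreover have "integral\<^sup>L lborel (g n) = 0" for n
    using integral_translate[OF meas, of "h n *\<^sub>R axis i 1"] translate_int int
    unfolding g_def by simp
  ultimately show ?thesis by (simp add: LIMSEQ_const_iff)
qed

lemma integral_by_parts:
  assumes "smooth g" "f \<in> test_functions_on K" "compact K"
  shows "(LINT x|lborel. g x * partial_deriv i f x) = - (LINT x|lborel. partial_deriv i g x * f x)"
proof -
  note cl = compact_imp_closed[OF assms(3)]
  have "(LINT x|lborel. g x * partial_deriv i f x + partial_deriv i g x * f x) = 0"
    using integral_partial_deriv[OF test_functions_on_mult[OF assms(1,2) cl] assms(3), of i]
    by (simp add: partial_deriv_mult assms test_functions_on_smooth[OF assms(2)])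
  moreover have "integrable lborel (\<lambda>x. g x * partial_deriv i f x)"
    using assms cl by (intro test_functions_on_integrable[OF _ assms(3)] test_functions_on_mult test_functions_on_partial)
  moreover have "integrable lborel (\<lambda>x. partial_deriv i g x * f x)"
    using assms cl by (intro test_functions_on_integrable[OF _ assms(3)] test_functions_on_mult smooth_partial)
  ultimately show ?thesis by (simp add: add_eq_0_iff)
qed

text \<open>The set where \<open>f\<close> is nonzero is open and negligible, hence empty.\<close>

lemma continuous_nonneg_integral_0:
  fixes f :: "'a::euclidean_space \<Rightarrow> real"
  assumes "continuous_on UNIV f" "\<And>x. f x \<ge> 0" "integrable lborel f" "integral\<^sup>L lborel f = 0"
  shows "f x = 0"
proof -
  have "AE x in lborel. f x = 0"
    using assms integral_nonneg_eq_0_iff_AE[of lborel f] by simp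
  then have "{x. f x \<noteq> 0} \<in> null_sets lborel"
    using assms(3) by (subst (asm) AE_iff_null) auto
  then have "negligible {x. f x \<noteq> 0}"
    by (simp add: negligible_iff_null_sets null_sets_completionI)
  moreover have "open {x. f x \<noteq> 0}"
    using assms(1) by (intro open_Collect_neq continuous_on_const)
  ultimately show ?thesis using open_not_negligible by blast
qed

text \<open>The path runs backwards from \<open>x\<close>. If \<open>f\<close> vanishes at all
  points of the line lying \<open>T\<close> or more behind \<open>x\<close>, this is the primitive
  of \<open>f\<close> in direction \<open>i\<close> that starts from 0.\<close>

definition line_integral :: "real \<Rightarrow> 'n::finite \<Rightarrow> (real^'n \<Rightarrow> complex) \<Rightarrow> real^'n \<Rightarrow> complex" where
  "line_integral T i f x = integral {0..T} (\<lambda>s. f (x - s *\<^sub>R axis i 1))"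

lemma continuous_on_shift:
  fixes f :: "real^'n::finite \<Rightarrow> complex"
  assumes "smooth f"
  shows "continuous_on S (\<lambda>(t, s::real). f (x + t *\<^sub>R axis j 1 - s *\<^sub>R axis i 1))"
    and "continuous_on S' (\<lambda>(x, s::real). f (x - s *\<^sub>R axis i 1))"
    and "continuous_on S'' (\<lambda>s::real. f (x - s *\<^sub>R axis i 1))"
proof -
  note c = continuous_on_compose2[OF smooth_continuous[OF assms, of UNIV] _ subset_UNIV]
  show "continuous_on S (\<lambda>(t, s::real). f (x + t *\<^sub>R axis j 1 - s *\<^sub>R axis i 1))"
    unfolding split_beta by (intro c continuous_on_add continuous_on_diff continuous_on_scaleR
        continuous_on_const continuous_on_fst continuous_on_snd continuous_on_id)
  show "continuous_on S' (\<lambda>(x, s::real). f (x - s *\<^sub>R axis i 1))"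
    unfolding split_beta by (intro c continuous_on_add continuous_on_diff continuous_on_scaleR
        continuous_on_const continuous_on_fst continuous_on_snd continuous_on_id)
  show "continuous_on S'' (\<lambda>s::real. f (x - s *\<^sub>R axis i 1))"
    by (intro c continuous_on_add continuous_on_diff continuous_on_scaleR
        continuous_on_const continuous_on_id)
qed

lemma has_pd_line_integral:
  fixes f :: "real^'n::finite \<Rightarrow> complex"
  assumes "smooth f"
  shows "has_pd j (line_integral T i f) (line_integral T i (partial_deriv j f))"
  unfolding has_pd_def
proof
  fix x :: "real^'n"
  have "((\<lambda>t. integral (cbox 0 T) (\<lambda>s. f (x + t *\<^sub>R axis j 1 - s *\<^sub>R axis i 1))) has_vector_derivative
      integral (cbox 0 T) (\<lambda>s. partial_deriv j f (x + 0 *\<^sub>R axis j 1 - s *\<^sub>R axis i 1))) (at 0 within UNIV)"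
  proof (rule leibniz_rule_vector_derivative)
    fix t s :: real
    show "((\<lambda>t. f (x + t *\<^sub>R axis j 1 - s *\<^sub>R axis i 1)) has_vector_derivative
      partial_deriv j f (x + t *\<^sub>R axis j 1 - s *\<^sub>R axis i 1)) (at t within UNIV)"
      using has_pd_at[OF smooth_has_pd[OF assms, of j], of "x - s *\<^sub>R axis i 1" t]
      by (simp add: algebra_simps)
    show "(\<lambda>s. f (x + t *\<^sub>R axis j 1 - s *\<^sub>R axis i 1)) integrable_on cbox 0 T"
      by (intro integrable_continuous continuous_on_shift assms)
    show "continuous_on (UNIV \<times> cbox 0 T) (\<lambda>(t, s). partial_deriv j f (x + t *\<^sub>R axis j 1 - s *\<^sub>R axis i 1))"
      by (intro continuous_on_shift smooth_partial assms)
  qed auto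
  then show "((\<lambda>t. line_integral T i f (x + t *\<^sub>R axis j 1)) has_vector_derivative
      line_integral T i (partial_deriv j f) x) (at 0)"
    by (simp add: line_integral_def)
qed

lemma smooth_line_integral:
  fixes f :: "real^'n::finite \<Rightarrow> complex"
  assumes "smooth f"
  shows "smooth (line_integral T i f)"
proof -
  have "\<exists>g. smooth g \<and> line_integral T i f = line_integral T i g" using assms by blast
  then show ?thesis
  proof (rule smooth_coinduct[where P = "\<lambda>h. \<exists>g. smooth g \<and> h = line_integral T i g"])
    fix h assume "\<exists>g. smooth g \<and> h = line_integral T i g"
    then obtain g where g: "smooth g" "h = line_integral T i g" by blast
    show "continuous_on UNIV h"
      unfolding g(2) line_integral_def[abs_def] box_real[symmetric]
      by (intro integral_continuous_on_param continuous_on_shift g(1))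
    fix j
    show "\<exists>h'. has_pd j h h' \<and> ((\<exists>g. smooth g \<and> h' = line_integral T i g) \<or> smooth h')"
      using has_pd_line_integral[OF g(1), of j T i] smooth_partial[OF g(1)] g(2) by blast
  qed
qed

lemma line_integral_partial_deriv:
  fixes f :: "real^'n::finite \<Rightarrow> complex"
  assumes "smooth f" "T \<ge> 0"
  shows "line_integral T i (partial_deriv i f) x = f x - f (x - T *\<^sub>R axis i 1)"
proof -
  have "((\<lambda>s. partial_deriv i f (x - s *\<^sub>R axis i 1)) has_integral
      (- f (x - T *\<^sub>R axis i 1) - - f (x - 0 *\<^sub>R axis i 1))) {0..T}"
  proof (rule fundamental_theorem_of_calculus[OF assms(2)])
    fix s :: real
    have "((\<lambda>t. f (x + t *\<^sub>R axis i 1)) \<circ> uminus has_vector_derivative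
        (-1) *\<^sub>R partial_deriv i f (x + (- s) *\<^sub>R axis i 1)) (at s)"
      by (intro vector_diff_chain_at has_pd_at smooth_has_pd assms)
        (auto intro!: derivative_eq_intros)
    then have "((\<lambda>t. - f (x - t *\<^sub>R axis i 1)) has_vector_derivative
        - (- partial_deriv i f (x - s *\<^sub>R axis i 1))) (at s)"
      by (intro has_vector_derivative_minus) (simp add: o_def)
    then show "((\<lambda>t. - f (x - t *\<^sub>R axis i 1)) has_vector_derivative
        partial_deriv i f (x - s *\<^sub>R axis i 1)) (at s within {0..T})"
      by (simp add: has_vector_derivative_at_within)
  qed
  then show ?thesis by (simp add: line_integral_def integral_unique)
qed

text \<open>Differentiation along \<open>j\<close> commutes with \<open>line_integral T i\<close>,
  which in turn undoes the derivative along \<open>i\<close> up to a translate. Comparing the two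
  orders shows that the difference \<open>D\<close> of the mixed derivatives has integral 0 over
  every segment starting at \<open>x\<close>; differentiating in the length gives
  \<open>D 0 = 0\<close>.\<close>

lemma partial_deriv_commute:
  fixes f :: "real^'n::finite \<Rightarrow> complex"
  assumes "smooth f"
  shows "partial_deriv i (partial_deriv j f) = partial_deriv j (partial_deriv i f)"
proof
  fix x
  define D where "D s = partial_deriv i (partial_deriv j f) (x - s *\<^sub>R axis i 1)
      - partial_deriv j (partial_deriv i f) (x - s *\<^sub>R axis i 1)" for s :: real
  have sm: "smooth (partial_deriv i (partial_deriv j f))" "smooth (partial_deriv j (partial_deriv i f))"
    by (intro smooth_partial assms)+
  have D_int: "integral {0..T} D = 0" if "T \<ge> 0" for T
  proof -
    have shift: "has_pd j (\<lambda>x. f (x - T *\<^sub>R axis i 1)) (\<lambda>x. partial_deriv j f (x - T *\<^sub>R axis i 1))"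
      unfolding has_pd_def
    proof
      fix x
      show "((\<lambda>t. f (x + t *\<^sub>R axis j 1 - T *\<^sub>R axis i 1)) has_vector_derivative
         partial_deriv j f (x - T *\<^sub>R axis i 1)) (at 0)"
        using has_pd_at[OF smooth_has_pd[OF assms, of j], of "x - T *\<^sub>R axis i 1" 0]
        by (simp add: algebra_simps)
    qed
    have "line_integral T i (partial_deriv j (partial_deriv i f))
        = partial_deriv j (line_integral T i (partial_deriv i f))"
      by (rule has_pd_partial[OF has_pd_line_integral[OF smooth_partial[OF assms]], symmetric])
    also have "line_integral T i (partial_deriv i f) = (\<lambda>x. f x - f (x - T *\<^sub>R axis i 1))"
      by (intro ext) (rule line_integral_partial_deriv[OF assms that])
    also have "partial_deriv j (\<lambda>x. f x - f (x - T *\<^sub>R axis i 1))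
        = (\<lambda>x. partial_deriv j f x - partial_deriv j f (x - T *\<^sub>R axis i 1))"
      by (intro has_pd_partial has_pd_diff smooth_has_pd assms shift)
    also have "\<dots> = line_integral T i (partial_deriv i (partial_deriv j f))"
      by (intro ext) (rule line_integral_partial_deriv[OF smooth_partial[OF assms] that, symmetric])
    finally have "line_integral T i (partial_deriv j (partial_deriv i f)) x
        = line_integral T i (partial_deriv i (partial_deriv j f)) x" by simp
    then show ?thesis
      using integrable_continuous_interval[OF continuous_on_shift(3)[OF sm(1)]]
        integrable_continuous_interval[OF continuous_on_shift(3)[OF sm(2)]]
      unfolding D_def line_integral_def by (simp add: integral_diff)
  qed
  \<comment> \<open>\<open>D_int\<close> covers only \<open>T \<ge> 0\<close>, so the derivative at
    0 is taken within the interval from 0 to 1, where it is still unique.\<close>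
  have "((\<lambda>T. integral {0..T} D) has_vector_derivative D 0) (at 0 within cbox 0 1)"
    unfolding box_real D_def
    by (intro integral_has_vector_derivative continuous_on_diff continuous_on_shift sm) auto
  moreover have "((\<lambda>T. integral {0..T} D) has_vector_derivative 0) (at 0 within cbox 0 1)"
    by (rule has_vector_derivative_transform[where f = "\<lambda>_. 0"]) (auto simp: D_int)
  ultimately have "D 0 = 0"
    by (intro vector_derivative_unique_within_closed_interval[of 0 1 0]) auto
  then show "partial_deriv i (partial_deriv j f) x = partial_deriv j (partial_deriv i f) x"
    by (simp add: D_def)
qed

section \<open>Functionals with vanishing gradient\<close>

definition set_coord :: "'n::finite \<Rightarrow> real \<Rightarrow> real^'n \<Rightarrow> real^'n" where
  "set_coord i c x = (\<chi> j. if j = i then c else x $ j)"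

lemma set_coord_nth [simp]: "set_coord i c x $ j = (if j = i then c else x $ j)"
  by (simp add: set_coord_def)

lemma set_coord_same: "set_coord i (x $ i) x = x"
  by (simp add: vec_eq_iff)

lemma set_coord_set_coord [simp]: "set_coord i c (set_coord i d x) = set_coord i c x"
  by (simp add: vec_eq_iff)

lemma set_coord_commute: "i \<noteq> j \<Longrightarrow> set_coord i c (set_coord j d x) = set_coord j d (set_coord i c x)"
  by (simp add: vec_eq_iff)

lemma set_coord_diff_axis: "set_coord i c x - t *\<^sub>R axis i 1 = set_coord i (c - t) x"
  by (simp add: vec_eq_iff axis_def)

lemma continuous_on_set_coord: "continuous_on S (set_coord i c)"
proof -
  have "set_coord i c = (\<lambda>x. x + (c - x $ i) *\<^sub>R axis i 1)"
    by (auto simp: vec_eq_iff axis_def fun_eq_iff)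
  then show ?thesis by (auto intro!: continuous_intros)
qed

lemma has_pd_set_coord:
  assumes "smooth f"
  shows "has_pd j (\<lambda>x. f (set_coord i c x)) (\<lambda>x. if j = i then 0 else partial_deriv j f (set_coord i c x))"
proof (cases "j = i")
  case True
  then have "set_coord i c (x + t *\<^sub>R axis j 1) = set_coord i c x" for x t
    by (simp add: vec_eq_iff axis_def)
  then show ?thesis using True by (simp add: has_pd_def)
next
  case False
  then have "set_coord i c (x + t *\<^sub>R axis j 1) = set_coord i c x + t *\<^sub>R axis j 1" for x t
    by (simp add: vec_eq_iff axis_def)
  then show ?thesis using False smooth_has_pd[OF assms, of j] by (simp add: has_pd_def)
qed

lemma smooth_set_coord:
  assumes "smooth f"
  shows "smooth (\<lambda>x. f (set_coord i c x))"
proof -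
  have "\<exists>g. smooth g \<and> (\<lambda>x. f (set_coord i c x)) = (\<lambda>x. g (set_coord i c x))" using assms by blast
  then show ?thesis
  proof (rule smooth_coinduct[where P = "\<lambda>h. \<exists>g. smooth g \<and> h = (\<lambda>x. g (set_coord i c x))"])
    fix h :: "real^'a \<Rightarrow> complex" assume "\<exists>g. smooth g \<and> h = (\<lambda>x. g (set_coord i c x))"
    then obtain g where g: "smooth g" "h = (\<lambda>x. g (set_coord i c x))" by blast
    show "continuous_on UNIV h"
      unfolding g(2) by (rule continuous_on_compose2[OF smooth_continuous[OF g(1)] continuous_on_set_coord subset_UNIV])
    fix j
    show "\<exists>h'. has_pd j h h' \<and> ((\<exists>g. smooth g \<and> h' = (\<lambda>x. g (set_coord i c x))) \<or> smooth h')"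
    proof (cases "j = i")
      case True
      have "has_pd j h (\<lambda>_. 0)"
        using has_pd_set_coord[OF g(1), of j i c] by (simp add: True g(2))
      then show ?thesis using smooth_const by blast
    next
      case False
      have "has_pd j h (\<lambda>x. partial_deriv j g (set_coord i c x))"
        using has_pd_set_coord[OF g(1), of j i c] by (simp add: False g(2))
      then show ?thesis using smooth_partial[OF g(1)] by blast
    qed
  qed
qed

text \<open>The end point \<open>r $ i + 1\<close> and the length \<open>r $ i - l $ i + 2\<close> make the path of integration
  overshoot the box on both sides, so that the lemma below has no boundary cases.\<close>

definition fiber_integral :: "real^'n::finite \<Rightarrow> real^'n \<Rightarrow> 'n \<Rightarrow> (real^'n \<Rightarrow> complex) \<Rightarrow> real^'n \<Rightarrow> complex" where
  "fiber_integral l r i f x = line_integral (r $ i - l $ i + 2) i f (set_coord i (r $ i + 1) x)"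

lemma fiber_integral_alt:
  "fiber_integral l r i f x = integral {0..r $ i - l $ i + 2} (\<lambda>s. f (set_coord i (r $ i + 1 - s) x))"
  by (simp add: fiber_integral_def line_integral_def set_coord_diff_axis)

lemma fiber_integral_set_coord [simp]: "fiber_integral l r i f (set_coord i c x) = fiber_integral l r i f x"
  by (simp add: fiber_integral_alt)

lemma fiber_integral_invariant:
  assumes "\<And>c x. f (set_coord j c x) = f x"
  shows "fiber_integral l r i f (set_coord j c x) = fiber_integral l r i f x"
  using assms by (cases "i = j") (auto simp: fiber_integral_alt set_coord_commute[of i j])

lemma fiber_integral_mult:
  assumes "\<And>c x. g (set_coord i c x) = g x"
  shows "fiber_integral l r i (\<lambda>x. f x * g x) x = fiber_integral l r i f x * g x"
  using assms by (simp add: fiber_integral_alt)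

lemma smooth_fiber_integral: "smooth f \<Longrightarrow> smooth (fiber_integral l r i f)"
  unfolding fiber_integral_def[abs_def] by (intro smooth_set_coord smooth_line_integral)

lemma mem_cbox_set_coord: "x \<in> cbox l (r::real^'n::finite) \<Longrightarrow> l $ i \<le> c \<Longrightarrow> c \<le> r $ i \<Longrightarrow> set_coord i c x \<in> cbox l r"
  by (auto simp: mem_box_cart)

text \<open>The fibre integral is constant in coordinate \<open>i\<close>, and the bump restores the
  bound in that direction. If another coordinate of \<open>x\<close> lies outside the box, the whole
  fibre misses the box and the integral is 0.\<close>

lemma fiber_integral_test_function:
  fixes f :: "real^'n::finite \<Rightarrow> complex"
  assumes "f \<in> test_functions_on (cbox l r)"
  shows "(\<lambda>x. fiber_integral l r i f x * of_real (bump (l $ i) (r $ i) (x $ i))) \<in> test_functions_on (cbox l r)"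
proof -
  have "fiber_integral l r i f x * of_real (bump (l $ i) (r $ i) (x $ i)) = 0" if "x \<notin> cbox l r" for x
  proof (cases "l $ i \<le> x $ i \<and> x $ i \<le> r $ i")
    case True
    then have "set_coord i c x \<notin> cbox l r" for c
      using that mem_cbox_set_coord[of "set_coord i c x" l r i "x $ i"] by (auto simp: set_coord_same)
    then have "f (set_coord i c x) = 0" for c
      using assms by (simp add: test_functions_on_iff closed_cbox)
    then show ?thesis by (simp add: fiber_integral_alt)
  next
    case False
    then show ?thesis by (auto simp: bump_0)
  qed
  moreover have "smooth (\<lambda>x. fiber_integral l r i f x * of_real (bump (l $ i) (r $ i) (x $ i)))"
    by (intro smooth_mult smooth_fiber_integral smooth_bump test_functions_on_smooth[OF assms])
  ultimately show ?thesis by (simp add: test_functions_on_iff closed_cbox)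
qed

text \<open>The backward line integral \<open>J\<close> is a primitive as long as its starting point
  lies before the box. Beyond the box it has the value of the fibre integral, which is 0 by
  hypothesis, so it can be cut off there smoothly to give \<open>S\<close>.\<close>

lemma primitive_exists:
  fixes f :: "real^'n::finite \<Rightarrow> complex"
  assumes f: "f \<in> test_functions_on (cbox l r)" and lr: "l $ i \<le> r $ i"
    and 0: "\<And>x. fiber_integral l r i f x = 0"
  shows "\<exists>S\<in>test_functions_on (cbox l r). partial_deriv i S = f"
proof -
  define T where "T = r $ i - l $ i + 2"
  define J where "J = line_integral T i f"
  define S where "S x = (if x $ i \<le> r $ i + 1 then J x else 0)" for x
  have sm: "smooth f" and van: "\<And>x. x \<notin> cbox l r \<Longrightarrow> f x = 0"
    using f by (auto simp: test_functions_on_iff closed_cbox)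
  have T: "T \<ge> 0" using lr by (simp add: T_def)
  have smJ: "smooth J" unfolding J_def by (rule smooth_line_integral[OF sm])
  have "line_integral T i (partial_deriv i f) = (\<lambda>x. f x - f (x - T *\<^sub>R axis i 1))"
    by (intro ext) (rule line_integral_partial_deriv[OF sm T])
  then have pdJ: "has_pd i J (\<lambda>x. f x - f (x - T *\<^sub>R axis i 1))"
    using has_pd_line_integral[OF sm, of i T i] by (simp add: J_def)
  \<comment> \<open>On this strip the starting point, \<open>T\<close> behind, is before the box and
    the end point is beyond it, so \<open>J\<close> has derivative 0 along the fibre. Its constant
    value is read off at coordinate \<open>r $ i + 1\<close>, where it is the fibre
    integral.\<close>
  have J0: "J x = 0" if "r $ i < x $ i" "x $ i < r $ i + 2" for x
  proof -
    define y where "y = set_coord i (r $ i + 1) x"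
    have "((\<lambda>t. J (y + t *\<^sub>R axis i 1)) has_vector_derivative 0) (at t within {-1<..<1})"
      if "t \<in> {-1<..<1}" for t
    proof -
      have "y + t *\<^sub>R axis i 1 \<notin> cbox l r" "y + t *\<^sub>R axis i 1 - T *\<^sub>R axis i 1 \<notin> cbox l r"
        using that unfolding mem_box_cart not_all
        by (auto intro!: exI[of _ i] simp: y_def T_def axis_def)
      then show ?thesis
        using has_pd_at[OF pdJ, of y t] by (simp add: van has_vector_derivative_at_within)
    qed
    then obtain c where c: "\<And>t. t \<in> {-1<..<1} \<Longrightarrow> J (y + t *\<^sub>R axis i 1) = c"
      using has_vector_derivative_zero_constant[of "{-1<..<1}" "\<lambda>t. J (y + t *\<^sub>R axis i 1)"] by auto
    have "x = y + (x $ i - r $ i - 1) *\<^sub>R axis i 1"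
      by (simp add: y_def vec_eq_iff axis_def)
    then have "J x = c" using c[of "x $ i - r $ i - 1"] that by auto
    also have "c = J y" using c[of 0] by simp
    also have "J y = 0" using 0[of x] by (simp add: fiber_integral_def J_def T_def y_def)
    finally show ?thesis .
  qed
  have S0: "S x = 0" if "x $ i > r $ i" for x
    using J0[of x] that by (simp add: S_def)
  have SJ: "S x = J x" if "x $ i < r $ i + 2" for x
    using J0[of x] that by (auto simp: S_def)
  have o1: "open {x::real^'n. x $ i < r $ i + 2}" and o2: "open {x::real^'n. r $ i < x $ i}"
    by (simp_all add: open_halfspace_component_lt_cart open_halfspace_component_gt_cart)
  have smS: "smooth S"
  proof (rule smooth_local)
    fix x
    show "\<exists>U g. open U \<and> x \<in> U \<and> smooth g \<and> (\<forall>y\<in>U. S y = g y)"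
    proof (cases "x $ i < r $ i + 2")
      case True
      then show ?thesis using o1 smJ SJ by (intro exI[of _ "{x. x $ i < r $ i + 2}"] exI[of _ J]) auto
    next
      case False
      then show ?thesis using o2 smooth_const[of 0] S0
        by (intro exI[of _ "{x. r $ i < x $ i}"] exI[of _ "\<lambda>_. 0"]) auto
    qed
  qed
  \<comment> \<open>With \<open>x $ i \<le> r $ i\<close>, a coordinate \<open>j\<close> witnessing
    that \<open>x\<close> is outside the box keeps doing so along the backward path: for
    \<open>j = i\<close> the point is already below \<open>l $ i\<close> and only moves further
    down.\<close>
  have Svan: "S x = 0" if "x \<notin> cbox l r" for x
  proof (cases "x $ i \<le> r $ i")
    case True
    have "f (x - s *\<^sub>R axis i 1) = 0" if "s \<in> {0..T}" for s
    proof (rule van)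
      obtain j where j: "x $ j < l $ j \<or> r $ j < x $ j"
        using \<open>x \<notin> cbox l r\<close> by (auto simp: mem_box_cart not_le)
      show "x - s *\<^sub>R axis i 1 \<notin> cbox l r"
        using j True that unfolding mem_box_cart not_all
        by (auto intro!: exI[of _ j] simp: axis_def)
    qed
    then have "J x = integral {0..T} (\<lambda>s. 0)"
      unfolding J_def line_integral_def by (intro integral_cong) auto
    then show ?thesis by (simp add: S_def)
  next
    case False
    then show ?thesis by (simp add: S0)
  qed
  have "has_pd i S f"
    unfolding has_pd_def
  proof
    fix x
    show "((\<lambda>t. S (x + t *\<^sub>R axis i 1)) has_vector_derivative f x) (at 0)"
    proof (cases "x $ i < r $ i + 2")
      case True
      then have "x - T *\<^sub>R axis i 1 \<notin> cbox l r"
        unfolding mem_box_cart not_all by (intro exI[of _ i]) (auto simp: T_def)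
      then have "((\<lambda>t. J (x + t *\<^sub>R axis i 1)) has_vector_derivative f x) (at 0)"
        using has_pd_at[OF pdJ, of x 0] by (simp add: van)
      then show ?thesis using True SJ o1
        by (intro has_pd_cong_open[of "{x. x $ i < r $ i + 2}" x S J]) auto
    next
      case False
      then have "x \<notin> cbox l r"
        unfolding mem_box_cart not_all by (intro exI[of _ i]) auto
      then show ?thesis using False S0 o2
        by (intro has_pd_cong_open[of "{x. r $ i < x $ i}" x S "\<lambda>_. 0"]) (auto simp: van)
    qed
  qed
  then have "partial_deriv i S = f" by (rule has_pd_partial)
  moreover have "S \<in> test_functions_on (cbox l r)"
    using smS Svan by (simp add: test_functions_on_iff closed_cbox)
  ultimately show ?thesis by blast
qed

lemma continuous_on_bump_reflected: "continuous_on S (\<lambda>s. bump a b (c - s))"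
  by (rule continuous_on_compose2[OF continuous_on_bump[of UNIV] _ subset_UNIV])
     (intro continuous_on_diff continuous_on_const continuous_on_id)

lemma bump_integral_pos:
  assumes "a < b"
  shows "integral {0..b - a + 2} (\<lambda>s. bump a b (b + 1 - s)) > 0"
proof -
  note c = continuous_on_bump_reflected[of "{0..b - a + 2}" a b "b + 1"]
  \<comment> \<open>The parameter \<open>1 + (b - a) / 2\<close> is where the path passes the
    midpoint of the interval from \<open>a\<close> to \<open>b\<close>.\<close>
  have "bump a b (b + 1 - (1 + (b - a) / 2)) > 0"
    using assms by (intro bump_pos) (auto simp: field_simps)
  then have "integral {0..b - a + 2} (\<lambda>s. bump a b (b + 1 - s)) \<noteq> 0"
    using assms by (subst integral_eq_0_iff[OF c]) (auto simp: bump_nonneg intro!: bexI[of _ "1 + (b - a) / 2"])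
  moreover have "integral {0..b - a + 2} (\<lambda>s. bump a b (b + 1 - s)) \<ge> 0"
    using c by (intro integral_nonneg integrable_continuous_interval) (auto simp: bump_nonneg)
  ultimately show ?thesis by linarith
qed

text \<open>Let \<open>\<kappa>\<close> be the fibre integral of the bump. Subtracting
  1/\<open>\<kappa>\<close> times fibre integral times bump leaves a function with zero fibre
  integrals, which has a primitive; hence \<open>c\<close> is 1/\<open>\<kappa>\<close>.\<close>

lemma separate_coordinate:
  fixes f :: "real^'n::finite \<Rightarrow> complex"
  assumes f: "f \<in> test_functions_on (cbox l r)" and lr: "l $ i < r $ i"
  shows "\<exists>c. \<exists>S\<in>test_functions_on (cbox l r).
    f = (\<lambda>x. c * (fiber_integral l r i f x * of_real (bump (l $ i) (r $ i) (x $ i))) + partial_deriv i S x)"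
proof -
  define \<kappa> where "\<kappa> = integral {0..r $ i - l $ i + 2} (\<lambda>s. bump (l $ i) (r $ i) (r $ i + 1 - s))"
  have \<kappa>: "\<kappa> > 0" unfolding \<kappa>_def by (rule bump_integral_pos[OF lr])
  define b where "b x = complex_of_real (bump (l $ i) (r $ i) (x $ i))" for x :: "real^'n"
  define p where "p x = fiber_integral l r i f x * b x" for x
  have p: "p \<in> test_functions_on (cbox l r)"
    using fiber_integral_test_function[OF f, of i] by (simp add: p_def[abs_def] b_def)
  define \<phi> where "\<phi> x = f x - of_real (1 / \<kappa>) * p x" for x
  have cp: "(\<lambda>x. of_real (1 / \<kappa>) * p x) \<in> test_functions_on (cbox l r)"
    by (intro test_functions_on_mult smooth_const p closed_cbox)
  have \<phi>: "\<phi> \<in> test_functions_on (cbox l r)"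
    unfolding \<phi>_def[abs_def] by (intro test_functions_on_diff f cp closed_cbox)
  have int: "(\<lambda>s. g (set_coord i (r $ i + 1 - s) x)) integrable_on {0..r $ i - l $ i + 2}"
    if "smooth g" for g :: "real^'n \<Rightarrow> complex" and x
    using integrable_continuous_interval[OF continuous_on_shift(3)[OF that, of _ "set_coord i (r $ i + 1) x" i]]
    by (simp add: set_coord_diff_axis)
  have fb: "fiber_integral l r i b x = of_real \<kappa>" for x
    unfolding fiber_integral_alt b_def \<kappa>_def
    using integral_linear[of _ _ complex_of_real, OF integrable_continuous_interval[OF continuous_on_bump_reflected] bounded_linear_of_real]
    by (simp add: o_def)
  have "fiber_integral l r i p x = fiber_integral l r i f x * of_real \<kappa>" for x
    using fiber_integral_mult[of "fiber_integral l r i f" i l r b x] fb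
    by (simp add: p_def[abs_def] mult.commute)
  then have "fiber_integral l r i \<phi> x = 0" for x
    using \<kappa> integral_diff[OF int[OF test_functions_on_smooth[OF f], of x] int[OF test_functions_on_smooth[OF cp], of x]]
    by (simp add: \<phi>_def[abs_def] fiber_integral_alt)
  then obtain S where "S \<in> test_functions_on (cbox l r)" "partial_deriv i S = \<phi>"
    using primitive_exists[OF \<phi> less_imp_le[OF lr]] by blast
  then show ?thesis
    by (intro exI[of _ "of_real (1 / \<kappa>)"] bexI[of _ S]) (auto simp: \<phi>_def p_def b_def)
qed

section \<open>Reduction of test functions modulo derivatives\<close>

definition linear_functional_on :: "(real^'n::finite \<Rightarrow> complex) set \<Rightarrow> ((real^'n \<Rightarrow> complex) \<Rightarrow> complex) \<Rightarrow> bool" where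
  "linear_functional_on D u \<longleftrightarrow>
     (\<forall>\<phi>\<in>D. \<forall>\<psi>\<in>D. u (\<lambda>x. \<phi> x + \<psi> x) = u \<phi> + u \<psi>) \<and> (\<forall>\<phi>\<in>D. \<forall>c. u (\<lambda>x. c * \<phi> x) = c * u \<phi>)"

lemma linear_functional_onD:
  assumes "linear_functional_on D u" "\<phi> \<in> D"
  shows "\<psi> \<in> D \<Longrightarrow> u (\<lambda>x. \<phi> x + \<psi> x) = u \<phi> + u \<psi>" "u (\<lambda>x. c * \<phi> x) = c * u \<phi>"
  using assms by (auto simp: linear_functional_on_def)

lemma linear_functional_on_integral:
  fixes K :: "(real^'n::finite) set"
  assumes "smooth g" "compact K"
  shows "linear_functional_on (test_functions_on K) (\<lambda>\<phi>. LINT x|lborel. g x * \<phi> x)"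
proof -
  have i: "integrable lborel (\<lambda>x. g x * \<phi> x)" if "\<phi> \<in> test_functions_on K" for \<phi>
    using assms that
    by (intro test_functions_on_integrable[OF test_functions_on_mult]) (auto intro: compact_imp_closed)
  show ?thesis
    unfolding linear_functional_on_def
    by (auto simp: distrib_left mult.left_commute[of "g _"] Bochner_Integration.integral_add[OF i i])
qed

text \<open>\<open>g\<close> is chosen before \<open>u\<close>, so that one decomposition of
  \<open>f\<close> can be evaluated both by the given functional and by the integral. Each step
  integrates out one more coordinate, which preserves invariance in those already treated; for
  \<open>I = UNIV\<close> the factor \<open>g\<close> becomes constant.\<close>

lemma separate_coordinates:
  fixes f :: "real^'n::finite \<Rightarrow> complex" and I :: "'n set"
  assumes f: "f \<in> test_functions_on (cbox l r)" and lr: "\<And>i. l $ i < r $ i"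
  shows "\<exists>g. (\<forall>i\<in>I. \<forall>c x. g (set_coord i c x) = g x) \<and>
    (\<lambda>x. g x * (\<Prod>i\<in>I. of_real (bump (l $ i) (r $ i) (x $ i)))) \<in> test_functions_on (cbox l r) \<and>
    (\<forall>u. linear_functional_on (test_functions_on (cbox l r)) u \<longrightarrow>
      (\<forall>i. \<forall>\<psi>\<in>test_functions_on (cbox l r). u (partial_deriv i \<psi>) = 0) \<longrightarrow>
      u f = u (\<lambda>x. g x * (\<Prod>i\<in>I. of_real (bump (l $ i) (r $ i) (x $ i)))))"
  using finite[of I]
proof (induction I rule: finite_induct)
  case empty
  then show ?case using f by (intro exI[of _ f]) simp
next
  case (insert j I)
  let ?D = "test_functions_on (cbox l r)"
  let ?b = "\<lambda>i x. complex_of_real (bump (l $ i) (r $ i) (x $ i))"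
  from insert.IH obtain g where g: "\<And>i c x. i \<in> I \<Longrightarrow> g (set_coord i c x) = g x"
    and D: "(\<lambda>x. g x * (\<Prod>i\<in>I. ?b i x)) \<in> ?D"
    and u: "\<And>u. linear_functional_on ?D u \<Longrightarrow> (\<And>i \<psi>. \<psi> \<in> ?D \<Longrightarrow> u (partial_deriv i \<psi>) = 0) \<Longrightarrow>
      u f = u (\<lambda>x. g x * (\<Prod>i\<in>I. ?b i x))"
    by blast
  let ?h = "\<lambda>x. g x * (\<Prod>i\<in>I. ?b i x)"
  obtain c S where S: "S \<in> ?D" "?h = (\<lambda>x. c * (fiber_integral l r j ?h x * ?b j x) + partial_deriv j S x)"
    using separate_coordinate[OF D lr[of j]] by blast
  \<comment> \<open>The bumps in the coordinates of \<open>I\<close> do not depend on coordinate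
    \<open>j\<close> and come out of the fibre integral.\<close>
  have "fiber_integral l r j ?h x = fiber_integral l r j g x * (\<Prod>i\<in>I. ?b i x)" for x
    using insert.hyps by (intro fiber_integral_mult prod.cong) auto
  then have eq: "(\<lambda>x. fiber_integral l r j ?h x * ?b j x) = (\<lambda>x. fiber_integral l r j g x * (\<Prod>i\<in>insert j I. ?b i x))"
    using insert.hyps by (simp add: mult_ac)
  have D': "(\<lambda>x. fiber_integral l r j g x * (\<Prod>i\<in>insert j I. ?b i x)) \<in> ?D"
    using fiber_integral_test_function[OF D, of j] by (simp only: eq)
  let ?g = "\<lambda>x. c * fiber_integral l r j g x"
  have cD': "(\<lambda>x. c * (fiber_integral l r j g x * (\<Prod>i\<in>insert j I. ?b i x))) \<in> ?D"
    by (intro test_functions_on_mult smooth_const D' closed_cbox)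
  show ?case
  proof (intro exI[of _ ?g] conjI ballI allI impI)
    fix i d x assume "i \<in> insert j I"
    then show "?g (set_coord i d x) = ?g x"
      using g by (cases "i = j") (auto simp: fiber_integral_invariant)
  next
    show "(\<lambda>x. ?g x * (\<Prod>i\<in>insert j I. ?b i x)) \<in> ?D"
      using cD' by (simp only: mult.assoc)
  next
    fix u assume l: "linear_functional_on ?D u" and k: "\<forall>i. \<forall>\<psi>\<in>?D. u (partial_deriv i \<psi>) = 0"
    have "u f = u ?h" using u[OF l] k by blast
    also have "?h = (\<lambda>x. c * (fiber_integral l r j g x * (\<Prod>i\<in>insert j I. ?b i x)) + partial_deriv j S x)"
      using S(2) unfolding eq[unfolded fun_eq_iff, rule_format] .
    also have "u \<dots> = u (\<lambda>x. c * (fiber_integral l r j g x * (\<Prod>i\<in>insert j I. ?b i x)))"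
      using linear_functional_onD(1)[OF l cD' test_functions_on_partial[OF S(1) closed_cbox]] k S(1) by simp
    finally show "u f = u (\<lambda>x. ?g x * (\<Prod>i\<in>insert j I. ?b i x))"
      by (simp only: mult.assoc)
  qed
qed

text \<open>The coordinates of \<open>x\<close> are replaced by those of \<open>y\<close> one at a
  time; \<open>I\<close> contains those where the two points may still differ.\<close>

lemma coordinate_invariant_const:
  assumes "\<And>i c x. g (set_coord i c x) = g x"
  shows "g x = g y"
proof -
  have "g x = g y" if "finite I" "\<And>i. i \<notin> I \<Longrightarrow> x $ i = y $ i" for I x
    using that
  proof (induction I arbitrary: x rule: finite_induct)
    case empty
    then have "x = y" by (simp add: vec_eq_iff)
    then show ?case by simp
  next
    case (insert i I)
    have "g (set_coord i (y $ i) x) = g y"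
      using insert.prems by (intro insert.IH) auto
    then show ?case using assms by simp
  qed
  then show ?thesis using finite[of UNIV] by blast
qed

lemma box_bump_integral_nonzero:
  assumes "\<And>i. l $ i < r $ (i::'n::finite)"
  shows "(LINT x|lborel. complex_of_real (box_bump l r x)) \<noteq> 0"
proof
  assume "(LINT x|lborel. complex_of_real (box_bump l r x)) = 0"
  then have 0: "(LINT x|lborel. box_bump l r x) = 0" by simp
  have D: "(\<lambda>x. complex_of_real (box_bump l r x)) \<in> test_functions_on (cbox l r)"
    using smooth_box_bump box_bump_0 box_subset_cbox by (fastforce simp: test_functions_on_iff closed_cbox)
  have "integrable lborel (\<lambda>x. complex_of_real (box_bump l r x))"
    by (rule test_functions_on_integrable[OF D compact_cbox])
  then have int: "integrable lborel (box_bump l r)"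
    by (simp add: complex_of_real_integrable_eq)
  have "continuous_on UNIV (box_bump l r)"
    using continuous_on_Re[OF smooth_continuous[OF smooth_box_bump[of l r], of UNIV]] by simp
  then have "box_bump l r ((1/2) *\<^sub>R (l + r)) = 0"
    by (rule continuous_nonneg_integral_0[OF _ box_bump_nonneg int 0])
  moreover have "(1/2) *\<^sub>R (l + r) \<in> box l r"
    using assms by (auto simp: mem_box_cart field_simps)
  ultimately show False using box_bump_pos by fastforce
qed

text \<open>Both \<open>u\<close> and the integral annihilate derivatives, so both turn
  \<open>\<phi>\<close> into the same constant \<open>g 0\<close> times their value on the product
  bump. The quotient of these two values is \<open>C\<close>.\<close>

lemma gradient_free_functional:
  fixes u :: "(real^'n::finite \<Rightarrow> complex) \<Rightarrow> complex"
  assumes lr: "\<And>i. l $ i < r $ i"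
    and lin: "linear_functional_on (test_functions_on (cbox l r)) u"
    and u0: "\<And>i \<psi>. \<psi> \<in> test_functions_on (cbox l r) \<Longrightarrow> u (partial_deriv i \<psi>) = 0"
  shows "\<exists>C. \<forall>\<phi>\<in>test_functions_on (cbox l r). u \<phi> = (LINT x|lborel. C * \<phi> x)"
proof -
  let ?D = "test_functions_on (cbox l r)"
  let ?b = "\<lambda>x. complex_of_real (box_bump l r x)"
  have linI: "linear_functional_on ?D (\<lambda>\<phi>. LINT x|lborel. 1 * \<phi> x)"
    by (intro linear_functional_on_integral smooth_const compact_cbox)
  have b: "?b \<in> ?D"
    using smooth_box_bump box_bump_0 box_subset_cbox by (fastforce simp: test_functions_on_iff closed_cbox)
  let ?I = "LINT x|lborel. ?b x"
  show ?thesis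
  proof (intro exI[of _ "u ?b / ?I"] ballI)
    fix \<phi> assume \<phi>: "\<phi> \<in> ?D"
    obtain g where g: "\<And>i c x. g (set_coord i c x) = g x"
      and *: "\<And>u. linear_functional_on ?D u \<Longrightarrow> (\<And>i \<psi>. \<psi> \<in> ?D \<Longrightarrow> u (partial_deriv i \<psi>) = 0) \<Longrightarrow>
      u \<phi> = u (\<lambda>x. g x * ?b x)"
      using separate_coordinates[OF \<phi> lr, of UNIV] unfolding box_bump_def of_real_prod by blast
    have gc: "g = (\<lambda>x. g 0)" using coordinate_invariant_const[of g, OF g] by blast
    have "u \<phi> = u (\<lambda>x. g x * ?b x)" using * lin u0 by blast
    also have "\<dots> = g 0 * u ?b"
      by (subst gc) (rule linear_functional_onD(2)[OF lin b])
    finally have 1: "u \<phi> = g 0 * u ?b" .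
    have "(LINT x|lborel. 1 * \<phi> x) = (LINT x|lborel. 1 * (g x * ?b x))"
      by (rule *[OF linI]) (simp add: integral_partial_deriv[OF _ compact_cbox])
    also have "\<dots> = g 0 * ?I" by (subst gc) simp
    finally show "u \<phi> = (LINT x|lborel. (u ?b / ?I) * \<phi> x)"
      using 1 box_bump_integral_nonzero[OF lr] by (simp add: field_simps)
  qed
qed

section \<open>Polynomial functionals on a box\<close>

definition monomial :: "('n::finite \<Rightarrow> nat) \<Rightarrow> real^'n \<Rightarrow> complex" where
  "monomial \<beta> x = of_real (\<Prod>i\<in>UNIV. x $ i ^ \<beta> i)"

lemma smooth_coord: "smooth (\<lambda>x::real^'n::finite. of_real (x $ i))"
proof -
  define G :: "nat \<Rightarrow> real \<Rightarrow> real" where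
    "G k t = (if k = 0 then t else if k = 1 then 1 else 0)" for k t
  have "(G k has_real_derivative G (Suc k) t) (at t)" for k t
    by (cases "k = 0"; cases "k = 1") (auto simp: G_def[abs_def])
  from smooth_of_coord[of G, OF this] show ?thesis by (simp add: G_def)
qed

lemma smooth_power: "smooth f \<Longrightarrow> smooth (\<lambda>x. f x ^ k)"
  by (induction k) (auto intro!: smooth_const smooth_mult)

lemma smooth_monomial: "smooth (monomial \<beta>)"
  unfolding monomial_def[abs_def] of_real_prod of_real_power
  by (intro smooth_prod smooth_power smooth_coord)

text \<open>For \<open>\<beta> j = 0\<close> the truncated exponent \<open>\<beta> j - 1\<close> is
  harmless, since the factor \<open>of_nat (\<beta> j)\<close> is 0.\<close>

lemma has_pd_monomial:
  fixes \<beta> :: "'n::finite \<Rightarrow> nat"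
  shows "has_pd j (monomial \<beta>) (\<lambda>x. of_nat (\<beta> j) * monomial (\<beta>(j := \<beta> j - 1)) x)"
  unfolding has_pd_def
proof
  fix x :: "real^'n"
  have *: "(\<Prod>i\<in>UNIV. y $ i ^ \<gamma> i) = y $ j ^ \<gamma> j * (\<Prod>i\<in>UNIV - {j}. y $ i ^ \<gamma> i)"
    for y :: "real^'n" and \<gamma> :: "'n \<Rightarrow> nat"
    by (rule prod.remove) auto
  define P where "P = (\<Prod>i\<in>UNIV - {j}. x $ i ^ \<beta> i)"
  have 1: "(\<Prod>i\<in>UNIV - {j}. (x + t *\<^sub>R axis j 1) $ i ^ \<beta> i) = P" for t
    unfolding P_def by (intro prod.cong) (auto simp: axis_def)
  have 2: "(\<Prod>i\<in>UNIV - {j}. x $ i ^ (\<beta>(j := \<beta> j - 1)) i) = P"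
    unfolding P_def by (intro prod.cong) auto
  have "((\<lambda>t. (x $ j + t) ^ \<beta> j * P) has_real_derivative real (\<beta> j) * x $ j ^ (\<beta> j - 1) * P) (at 0)"
    by (auto intro!: derivative_eq_intros)
  then have "((\<lambda>t. complex_of_real ((x $ j + t) ^ \<beta> j * P)) has_vector_derivative
      of_real (real (\<beta> j) * x $ j ^ (\<beta> j - 1) * P)) (at 0)"
    by (intro has_vector_derivative_of_real) (simp add: has_real_derivative_iff_has_vector_derivative)
  moreover have "monomial \<beta> (x + t *\<^sub>R axis j 1) = of_real ((x $ j + t) ^ \<beta> j * P)" for t
    unfolding monomial_def * 1 by (simp add: axis_def)
  moreover have "of_nat (\<beta> j) * monomial (\<beta>(j := \<beta> j - 1)) x = of_real (real (\<beta> j) * x $ j ^ (\<beta> j - 1) * P)"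
    unfolding monomial_def * 2 by simp
  ultimately show "((\<lambda>t. monomial \<beta> (x + t *\<^sub>R axis j 1)) has_vector_derivative
      of_nat (\<beta> j) * monomial (\<beta>(j := \<beta> j - 1)) x) (at 0)"
    by (simp only:)
qed

text \<open>Each integration by parts moves one derivative to the monomial and lowers its exponent
  in \<open>j\<close>; with more derivatives than the exponent, the monomial is differentiated to
  0.\<close>

lemma monomial_integral_derivative:
  fixes \<psi> :: "real^'n::finite \<Rightarrow> complex"
  assumes K: "compact K" and \<psi>: "\<psi> \<in> test_functions_on K"
  shows "\<beta> j < k \<Longrightarrow> (LINT x|lborel. monomial \<beta> x * wderiv (replicate k j) \<psi> x) = 0"
proof (induction k arbitrary: \<beta>)
  case (Suc k)
  have D: "wderiv (replicate k j) \<psi> \<in> test_functions_on K"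
    by (rule test_functions_on_wderiv[OF \<psi> compact_imp_closed[OF K]])
  have "(LINT x|lborel. monomial \<beta> x * partial_deriv j (wderiv (replicate k j) \<psi>) x)
      = - (LINT x|lborel. (of_nat (\<beta> j) * monomial (\<beta>(j := \<beta> j - 1)) x) * wderiv (replicate k j) \<psi> x)"
    by (subst integral_by_parts[OF smooth_monomial D K]) (simp add: has_pd_partial[OF has_pd_monomial])
  also have "\<dots> = 0"
  proof (cases "\<beta> j = 0")
    case False
    then have "(LINT x|lborel. monomial (\<beta>(j := \<beta> j - 1)) x * wderiv (replicate k j) \<psi> x) = 0"
      using Suc.prems by (intro Suc.IH) auto
    then show ?thesis by (simp add: mult.assoc)
  qed simp
  finally show ?case by simp
qed simp

definition polynomial_of :: "('n::finite \<Rightarrow> nat) set \<Rightarrow> (('n \<Rightarrow> nat) \<Rightarrow> complex) \<Rightarrow> real^'n \<Rightarrow> complex" where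
  "polynomial_of A c x = (\<Sum>\<beta>\<in>A. c \<beta> * monomial \<beta> x)"

lemma complex_polynomial_iff: "complex_polynomial p \<longleftrightarrow> (\<exists>A c. finite A \<and> p = polynomial_of A c)"
  by (simp add: complex_polynomial_def polynomial_of_def[abs_def] monomial_def)

lemma smooth_polynomial_of: "smooth (polynomial_of A c)"
  unfolding polynomial_of_def[abs_def] by (intro smooth_sum smooth_cmult smooth_monomial)

text \<open>The exponents of the monomials that, for every \<open>i\<close>, are annihilated by
  \<open>\<alpha> i\<close> derivatives along \<open>i\<close>.\<close>

definition below :: "('n::finite \<Rightarrow> nat) \<Rightarrow> ('n \<Rightarrow> nat) set" where
  "below \<alpha> = {\<beta>. \<forall>i. \<beta> i < \<alpha> i}"

lemma finite_below: "finite (below (\<alpha> :: 'n::finite \<Rightarrow> nat))"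
proof -
  have "below \<alpha> = PiE UNIV (\<lambda>i. {..<\<alpha> i})"
    by (auto simp: below_def PiE_def Pi_def)
  then show ?thesis by (simp add: finite_PiE)
qed

lemma partial_deriv_wderiv_commute:
  "smooth f \<Longrightarrow> partial_deriv i (wderiv w f) = wderiv w (partial_deriv i f)"
  by (induction w) (simp_all add: partial_deriv_commute[OF smooth_wderiv])

text \<open>The minus sign anticipates integration by parts: pairing the primitive with
  \<open>partial_deriv i \<psi>\<close> then equals pairing
  \<open>polynomial_of (below (\<alpha>(i := \<alpha> i - 1))) c\<close> with \<open>\<psi>\<close>,
  with sign plus.\<close>

lemma polynomial_primitive:
  assumes "\<alpha> i > 0"
  shows "\<exists>d. has_pd i (polynomial_of (below \<alpha>) d) (\<lambda>x. - polynomial_of (below (\<alpha>(i := \<alpha> i - 1))) c x)"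
proof -
  \<comment> \<open>Coefficients are shifted up by one in direction \<open>i\<close>. Those with
    \<open>\<gamma> i = 0\<close> belong to terms with zero derivative and are a free choice, here
    0.\<close>
  define d where "d \<gamma> = (if \<gamma> i = 0 then 0 else - c (\<gamma>(i := \<gamma> i - 1)) / of_nat (\<gamma> i))" for \<gamma>
  have "(\<Sum>\<gamma>\<in>below \<alpha>. d \<gamma> * (of_nat (\<gamma> i) * monomial (\<gamma>(i := \<gamma> i - 1)) x))
      = - polynomial_of (below (\<alpha>(i := \<alpha> i - 1))) c x" for x
  proof -
    have "(\<Sum>\<gamma>\<in>below \<alpha>. d \<gamma> * (of_nat (\<gamma> i) * monomial (\<gamma>(i := \<gamma> i - 1)) x))
        = (\<Sum>\<gamma>\<in>{\<gamma> \<in> below \<alpha>. \<gamma> i \<noteq> 0}. - c (\<gamma>(i := \<gamma> i - 1)) * monomial (\<gamma>(i := \<gamma> i - 1)) x)"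
      by (intro sum.mono_neutral_cong_right finite_below) (auto simp: d_def)
    also have "\<dots> = (\<Sum>\<beta>\<in>below (\<alpha>(i := \<alpha> i - 1)). - c \<beta> * monomial \<beta> x)"
      using assms
      by (intro sum.reindex_bij_witness[where i = "\<lambda>\<beta>. \<beta>(i := \<beta> i + 1)" and j = "\<lambda>\<gamma>. \<gamma>(i := \<gamma> i - 1)"])
        (auto simp: below_def fun_eq_iff split: if_splits dest: spec[of _ i])
    finally show ?thesis by (simp add: polynomial_of_def sum_negf)
  qed
  moreover have "has_pd i (polynomial_of (below \<alpha>) d)
      (\<lambda>x. \<Sum>\<gamma>\<in>below \<alpha>. d \<gamma> * (of_nat (\<gamma> i) * monomial (\<gamma>(i := \<gamma> i - 1)) x))"
    unfolding polynomial_of_def[abs_def] by (intro has_pd_sum has_pd_cmult has_pd_monomial)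
  ultimately show ?thesis by auto
qed

lemma polynomial_integral_derivative:
  assumes "compact K" "\<psi> \<in> test_functions_on K" "\<And>\<beta>. \<beta> \<in> A \<Longrightarrow> \<beta> j < k"
  shows "(LINT x|lborel. polynomial_of A c x * wderiv (replicate k j) \<psi> x) = 0"
proof -
  have D: "wderiv (replicate k j) \<psi> \<in> test_functions_on K"
    by (rule test_functions_on_wderiv[OF assms(2) compact_imp_closed[OF assms(1)]])
  have i: "integrable lborel (\<lambda>x. monomial \<beta> x * wderiv (replicate k j) \<psi> x)" for \<beta>
    by (rule test_functions_on_integrable[OF test_functions_on_mult[OF smooth_monomial D compact_imp_closed[OF assms(1)]] assms(1)])
  have "(LINT x|lborel. polynomial_of A c x * wderiv (replicate k j) \<psi> x)
      = (\<Sum>\<beta>\<in>A. LINT x|lborel. c \<beta> * (monomial \<beta> x * wderiv (replicate k j) \<psi> x))"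
    unfolding polynomial_of_def sum_distrib_right mult.assoc
    by (intro Bochner_Integration.integral_sum integrable_mult_right i)
  also have "\<dots> = 0"
    using monomial_integral_derivative[OF assms(1,2)] assms(3) by simp
  finally show ?thesis .
qed

lemma polynomial_of_add_subset:
  assumes "finite A" "B \<subseteq> A"
  shows "polynomial_of A d x + polynomial_of B c x = polynomial_of A (\<lambda>\<beta>. d \<beta> + (if \<beta> \<in> B then c \<beta> else 0)) x"
proof -
  have "polynomial_of B c x = (\<Sum>\<beta>\<in>A. (if \<beta> \<in> B then c \<beta> else 0) * monomial \<beta> x)"
    unfolding polynomial_of_def using assms by (intro sum.mono_neutral_cong_left) auto
  then show ?thesis by (simp add: polynomial_of_def sum.distrib distrib_right)
qed

text \<open>The derivative along one coordinate of the functional is a polynomial by induction;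
  subtracting a primitive of it lowers the order in that coordinate to one.\<close>

lemma polynomial_functional_on_box:
  fixes u :: "(real^'n::finite \<Rightarrow> complex) \<Rightarrow> complex"
  assumes lr: "\<And>i. l $ i < r $ i"
    and "linear_functional_on (test_functions_on (cbox l r)) u"
    and "\<And>i \<psi>. \<psi> \<in> test_functions_on (cbox l r) \<Longrightarrow> u (wderiv (replicate (\<alpha> i) i) \<psi>) = 0"
  shows "\<exists>c. \<forall>\<phi>\<in>test_functions_on (cbox l r). u \<phi> = (LINT x|lborel. polynomial_of (below \<alpha>) c x * \<phi> x)"
  using assms(2,3)
proof (induction "\<Sum>i\<in>UNIV. \<alpha> i" arbitrary: \<alpha> u rule: less_induct)
  case less
  let ?D = "test_functions_on (cbox l r)"
  note lin = less.prems(1) and u0 = less.prems(2)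
  \<comment> \<open>A zero exponent makes the hypothesis say \<open>u = 0\<close> on the box,
    matching the empty set \<open>below \<alpha>\<close>. All exponents equal to 1 is the case of
    vanishing gradient. Otherwise all are positive and some exponent can be lowered to 1.\<close>
  consider i where "\<alpha> i = 0" | "\<And>i. \<alpha> i = 1" | i where "\<alpha> i \<ge> 2" "\<And>j. \<alpha> j > 0"
    by (metis One_nat_def less_2_cases not_gr_zero not_less)
  then show ?case
  proof cases
    case (1 i)
    have "u \<phi> = 0" if "\<phi> \<in> ?D" for \<phi>
      using u0[OF that, of i] 1 by simp
    then show ?thesis by (intro exI[of _ "\<lambda>_. 0"]) (simp add: polynomial_of_def)
  next
    case 2
    have "u (partial_deriv i \<psi>) = 0" if "\<psi> \<in> ?D" for i \<psi>
      using u0[OF that, of i] 2 by simp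
    from gradient_free_functional[OF lr lin this]
    obtain C where C: "\<And>\<phi>. \<phi> \<in> ?D \<Longrightarrow> u \<phi> = (LINT x|lborel. C * \<phi> x)"
      by blast
    have "below \<alpha> = {\<lambda>_. 0}" using 2 by (auto simp: below_def)
    then have "polynomial_of (below \<alpha>) (\<lambda>_. C) = (\<lambda>x. C)"
      by (auto simp: polynomial_of_def monomial_def)
    then show ?thesis using C by (intro exI[of _ "\<lambda>_. C"]) simp
  next
    case (3 i)
    let ?\<alpha>' = "\<alpha>(i := \<alpha> i - 1)" and ?\<alpha>'' = "\<alpha>(i := 1)"
    \<comment> \<open>Used with \<open>a = \<alpha> i - 1\<close> for the derivative
      \<open>v\<close> and with \<open>a = 1\<close> for the remainder \<open>w\<close>; the latter
      is smaller because \<open>\<alpha> i \<ge> 2\<close>.\<close>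
    have sum_upd: "(\<Sum>j\<in>UNIV. (\<alpha>(i := a)) j) < (\<Sum>j\<in>UNIV. \<alpha> j)" if "a < \<alpha> i" for a
      using that by (intro sum_strict_mono_ex1) (auto intro!: exI[of _ i])
    define v where "v \<psi> = u (partial_deriv i \<psi>)" for \<psi>
    have "linear_functional_on ?D v"
      using linear_functional_onD[OF lin test_functions_on_partial[OF _ closed_cbox]]
      unfolding linear_functional_on_def v_def
      by (simp add: partial_deriv_add partial_deriv_cmult test_functions_on_smooth test_functions_on_partial closed_cbox)
    moreover have "v (wderiv (replicate (?\<alpha>' j) j) \<psi>) = 0" if \<psi>: "\<psi> \<in> ?D" for j \<psi>
    proof (cases "j = i")
      case True
      have "Suc (\<alpha> i - 1) = \<alpha> i" using 3(1) by simp
      then have "partial_deriv i (wderiv (replicate (\<alpha> i - 1) i) \<psi>) = wderiv (replicate (\<alpha> i) i) \<psi>"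
        by (metis replicate_Suc wderiv_simps(2))
      then show ?thesis using u0[OF \<psi>, of i] True by (simp add: v_def)
    next
      case False
      then show ?thesis
        using u0[OF test_functions_on_partial[OF \<psi> closed_cbox], of j i]
        by (simp add: v_def partial_deriv_wderiv_commute[OF test_functions_on_smooth[OF \<psi>]])
    qed
    ultimately obtain c where c: "\<And>\<psi>. \<psi> \<in> ?D \<Longrightarrow> v \<psi> = (LINT x|lborel. polynomial_of (below ?\<alpha>') c x * \<psi> x)"
      using less.hyps[of ?\<alpha>' v, OF sum_upd] 3(1) by fastforce
    obtain d where d: "has_pd i (polynomial_of (below \<alpha>) d) (\<lambda>x. - polynomial_of (below ?\<alpha>') c x)"
      by (rule exE[OF polynomial_primitive[of \<alpha> i c, OF 3(2)[of i]]])
    let ?q = "polynomial_of (below \<alpha>) d"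
    define w where "w \<phi> = u \<phi> - (LINT x|lborel. ?q x * \<phi> x)" for \<phi>
    have linq: "linear_functional_on ?D (\<lambda>\<phi>. LINT x|lborel. ?q x * \<phi> x)"
      by (intro linear_functional_on_integral smooth_polynomial_of compact_cbox)
    have "linear_functional_on ?D w"
      using linear_functional_onD[OF lin] linear_functional_onD[OF linq]
      unfolding linear_functional_on_def w_def by (simp add: right_diff_distrib)
    moreover have "w (wderiv (replicate (?\<alpha>'' j) j) \<psi>) = 0" if \<psi>: "\<psi> \<in> ?D" for j \<psi>
    proof (cases "j = i")
      case True
      have "(LINT x|lborel. ?q x * partial_deriv i \<psi> x) = v \<psi>"
        by (subst integral_by_parts[OF smooth_polynomial_of \<psi> compact_cbox])
          (simp add: has_pd_partial[OF d] c[OF \<psi>])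
      then show ?thesis using True by (simp add: w_def v_def)
    next
      case False
      \<comment> \<open>The primitive has degree less than \<open>\<alpha> j\<close> in every other
        coordinate \<open>j\<close>, so subtracting it does not disturb the vanishing there.\<close>
      have "(LINT x|lborel. ?q x * wderiv (replicate (\<alpha> j) j) \<psi> x) = 0"
        by (rule polynomial_integral_derivative[OF compact_cbox \<psi>]) (simp add: below_def)
      then show ?thesis using u0[OF \<psi>, of j] False by (simp add: w_def)
    qed
    ultimately obtain c' where c': "\<And>\<phi>. \<phi> \<in> ?D \<Longrightarrow> w \<phi> = (LINT x|lborel. polynomial_of (below ?\<alpha>'') c' x * \<phi> x)"
      using less.hyps[of ?\<alpha>'' w, OF sum_upd] 3(1) by fastforce
    have sub: "below ?\<alpha>'' \<subseteq> below \<alpha>"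
    proof (clarsimp simp: below_def)
      fix \<beta> j assume "\<forall>j. (j = i \<longrightarrow> \<beta> i = 0) \<and> (j \<noteq> i \<longrightarrow> \<beta> j < \<alpha> j)"
      then show "\<beta> j < \<alpha> j" using 3(2) by (cases "j = i") auto
    qed
    have "u \<phi> = (LINT x|lborel. polynomial_of (below \<alpha>) (\<lambda>\<beta>. d \<beta> + (if \<beta> \<in> below ?\<alpha>'' then c' \<beta> else 0)) x * \<phi> x)"
      if \<phi>: "\<phi> \<in> ?D" for \<phi>
    proof -
      have i: "integrable lborel (\<lambda>x. polynomial_of A c x * \<phi> x)" for A c
        by (rule test_functions_on_integrable[OF test_functions_on_mult[OF smooth_polynomial_of \<phi> closed_cbox] compact_cbox])
      have "u \<phi> = (LINT x|lborel. ?q x * \<phi> x) + (LINT x|lborel. polynomial_of (below ?\<alpha>'') c' x * \<phi> x)"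
        using c'[OF \<phi>] by (simp add: w_def diff_eq_eq add.commute)
      also have "\<dots> = (LINT x|lborel. (?q x + polynomial_of (below ?\<alpha>'') c' x) * \<phi> x)"
        by (simp add: distrib_right Bochner_Integration.integral_add[OF i i])
      finally show ?thesis
        by (simp only: polynomial_of_add_subset[OF finite_below sub])
    qed
    then show ?thesis by blast
  qed
qed

section \<open>One order for all test functions on a compact set\<close>

text \<open>Convergence in the Frechet space of functions supported in \<open>K\<close>, expressed
  by uniform limits so that library results on uniform convergence apply.\<close>

definition test_converges :: "(real^'n::finite) set \<Rightarrow> (nat \<Rightarrow> real^'n \<Rightarrow> complex) \<Rightarrow> (real^'n \<Rightarrow> complex) \<Rightarrow> bool" where
  "test_converges K \<psi> \<phi> \<longleftrightarrow> (\<forall>n. \<psi> n \<in> test_functions_on K) \<and> \<phi> \<in> test_functions_on K \<and>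
     (\<forall>w. uniform_limit UNIV (\<lambda>n. wderiv w (\<psi> n)) (wderiv w \<phi>) sequentially)"

lemma test_converges_diff:
  assumes "test_converges K \<psi> \<phi>" "f \<in> test_functions_on L" "closed K" "closed L"
  shows "test_converges (K \<union> L) (\<lambda>n x. \<psi> n x - f x) (\<lambda>x. \<phi> x - f x)"
proof -
  have mem: "g \<in> test_functions_on K \<Longrightarrow> (\<lambda>x. g x - f x) \<in> test_functions_on (K \<union> L)" for g
    using assms(2-4) test_functions_on_mono[of _ K "K \<union> L"] test_functions_on_mono[of _ L "K \<union> L"]
    by (intro test_functions_on_diff) auto
  have wd: "g \<in> test_functions_on K \<Longrightarrow> wderiv w (\<lambda>x. g x - f x) = (\<lambda>x. wderiv w g x - wderiv w f x)" for g w
    by (rule wderiv_diff[OF test_functions_on_smooth test_functions_on_smooth[OF assms(2)]])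
  have \<psi>: "\<psi> n \<in> test_functions_on K" and \<phi>: "\<phi> \<in> test_functions_on K"
    and lim: "uniform_limit UNIV (\<lambda>n. wderiv w (\<psi> n)) (wderiv w \<phi>) sequentially" for n w
    using assms(1) by (auto simp: test_converges_def)
  have "uniform_limit UNIV (\<lambda>n. wderiv w (\<lambda>x. \<psi> n x - f x)) (wderiv w (\<lambda>x. \<phi> x - f x)) sequentially" for w
    using lim[of w] unfolding wd[OF \<psi>] wd[OF \<phi>] by (simp add: uniform_limit_iff dist_norm)
  then show ?thesis
    using mem \<psi> \<phi> by (simp add: test_converges_def)
qed

lemma test_converges_wderiv:
  assumes "test_converges K \<psi> \<phi>" "closed K"
  shows "test_converges K (\<lambda>n. wderiv v (\<psi> n)) (wderiv v \<phi>)"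
  using assms by (simp add: test_converges_def test_functions_on_wderiv wderiv_append[symmetric])

text \<open>Basic open sets are given by strict pointwise bounds. As the maximum over compact
  \<open>K\<close> is attained, such a bound leaves a uniform gap, in which a uniformly close
  function still fits.\<close>

lemma test_function_norm_less:
  assumes "f \<in> test_functions_on K" "compact K" "\<And>x. norm (f x) < e"
  obtains M where "M < e" "\<And>x. norm (f x) \<le> M"
proof (cases "K = {}")
  case True
  then have "f x = 0" for x
    using assms by (simp add: test_functions_on_iff)
  then show thesis using that[of 0] assms(3) by simp
next
  case False
  have "continuous_on K (\<lambda>x. norm (f x))"
    by (intro continuous_on_norm smooth_continuous test_functions_on_smooth[OF assms(1)])
  then obtain x0 where x0: "x0 \<in> K" "\<And>x. x \<in> K \<Longrightarrow> norm (f x) \<le> norm (f x0)"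
    using continuous_attains_sup[OF assms(2) False] by blast
  have "norm (f x) \<le> norm (f x0)" for x
  proof (cases "x \<in> K")
    case False
    then have "f x = 0" using assms(1) test_functions_on_iff[OF compact_imp_closed[OF assms(2)]] by blast
    then show ?thesis by simp
  qed (rule x0)
  then show thesis using that assms(3) by blast
qed

text \<open>The topology is given by generators, so the proof follows the generation of
  \<open>V\<close>: eventual membership survives finite intersections and unions, and on a generator
  the gap \<open>e - M\<close> absorbs the error.\<close>

lemma test_converges_eventually_on:
  assumes "openin (test_topology_on K) V" "\<phi> \<in> V" "test_converges K \<psi> \<phi>" "compact K"
  shows "\<forall>\<^sub>F n in sequentially. \<psi> n \<in> V"
  using openin_topology_generated_by[OF assms(1)[unfolded test_topology_on_def]] assms(2)
proof (induction V rule: generate_topology_on.induct)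
  case (Int a b)
  then show ?case by (auto intro: eventually_conj)
next
  case (UN F)
  then obtain V where V: "V \<in> F" "\<phi> \<in> V" by blast
  then have "\<forall>\<^sub>F n in sequentially. \<psi> n \<in> V" using UN by blast
  then show ?case by eventually_elim (use V in blast)
next
  case (Basis V)
  have cl: "closed K" using assms(4) by (rule compact_imp_closed)
  have \<psi>: "\<psi> n \<in> test_functions_on K" and \<phi>: "\<phi> \<in> test_functions_on K" for n
    using assms(3) by (auto simp: test_converges_def)
  from Basis(1) obtain \<alpha> \<phi>0 e where V: "V = {\<psi> \<in> test_functions_on K. \<forall>x. norm (mderiv \<alpha> (\<lambda>y. \<psi> y - \<phi>0 y) x) < e}"
    and \<phi>0: "\<phi>0 \<in> test_functions_on K" "e > 0" by blast
  obtain w where w: "mderiv \<alpha> f = wderiv w f" for f :: "real^'a \<Rightarrow> complex"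
    using mderiv_word by blast
  have wd: "wderiv w (\<lambda>x. g x - \<phi>0 x) = (\<lambda>x. wderiv w g x - wderiv w \<phi>0 x)"
    if "g \<in> test_functions_on K" for g
    by (rule wderiv_diff[OF test_functions_on_smooth[OF that] test_functions_on_smooth[OF \<phi>0(1)]])
  have "(\<lambda>x. wderiv w \<phi> x - wderiv w \<phi>0 x) \<in> test_functions_on K"
    by (intro test_functions_on_diff test_functions_on_wderiv \<phi> \<phi>0 cl)
  then obtain M where M: "M < e" "\<And>x. norm (wderiv w \<phi> x - wderiv w \<phi>0 x) \<le> M"
    using test_function_norm_less[OF _ assms(4), of "\<lambda>x. wderiv w \<phi> x - wderiv w \<phi>0 x" e]
      Basis(2) by (auto simp: V w wd[OF \<phi>])
  have "uniform_limit UNIV (\<lambda>n. wderiv w (\<psi> n)) (wderiv w \<phi>) sequentially"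
    using assms(3) by (simp add: test_converges_def)
  then have "\<forall>\<^sub>F n in sequentially. \<forall>x\<in>UNIV. dist (wderiv w (\<psi> n) x) (wderiv w \<phi> x) < e - M"
    using M(1) unfolding uniform_limit_iff by simp
  then show ?case
  proof eventually_elim
    case (elim n)
    have "norm (wderiv w (\<psi> n) x - wderiv w \<phi>0 x) < e" for x
    proof -
      have "norm (wderiv w (\<psi> n) x - wderiv w \<phi>0 x)
          \<le> norm (wderiv w (\<psi> n) x - wderiv w \<phi> x) + norm (wderiv w \<phi> x - wderiv w \<phi>0 x)"
        using norm_triangle_ineq[of "wderiv w (\<psi> n) x - wderiv w \<phi> x" "wderiv w \<phi> x - wderiv w \<phi>0 x"] by simp
      also have "\<dots> < (e - M) + M"
        using elim M(2)[of x] by (intro add_less_le_mono) (auto simp: dist_norm)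
      finally show ?thesis by simp
    qed
    then show ?case using \<psi> by (simp add: V w wd)
  qed
qed simp

lemma test_functions_support:
  "\<phi> \<in> test_functions \<Omega> \<Longrightarrow> \<phi> \<in> test_functions_on (support \<phi>) \<and> compact (support \<phi>) \<and> support \<phi> \<subseteq> \<Omega>"
  by (auto simp: test_functions_def test_functions_on_def)

text \<open>A generator is a translate of \<open>W\<close> by some \<open>f\<close>. Subtracting
  \<open>f\<close> moves the sequence into \<open>W\<close>, at the cost of enlarging
  \<open>K\<close> by the support of \<open>f\<close>; the union is a compact subset of
  \<open>\<Omega>\<close>, on which \<open>W\<close> is open.\<close>

lemma test_converges_eventually:
  assumes "openin (test_topology \<Omega>) V" "\<phi> \<in> V" "test_converges K \<psi> \<phi>" "compact K" "K \<subseteq> \<Omega>"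
  shows "\<forall>\<^sub>F n in sequentially. \<psi> n \<in> V"
  using openin_topology_generated_by[OF assms(1)[unfolded test_topology_def]] assms(2)
proof (induction V rule: generate_topology_on.induct)
  case (Int a b)
  then show ?case by (auto intro: eventually_conj)
next
  case (UN F)
  then obtain V where V: "V \<in> F" "\<phi> \<in> V" by blast
  then have "\<forall>\<^sub>F n in sequentially. \<psi> n \<in> V" using UN by blast
  then show ?case by eventually_elim (use V in blast)
next
  case (Basis V)
  from Basis(1) obtain f W where V: "V = (\<lambda>\<psi> x. f x + \<psi> x) ` W" and f: "f \<in> test_functions \<Omega>"
    and W: "\<And>K. compact K \<Longrightarrow> K \<subseteq> \<Omega> \<Longrightarrow> openin (test_topology_on K) (W \<inter> test_functions_on K)"
    by blast
  define L where "L = K \<union> support f"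
  have L: "compact L" "L \<subseteq> \<Omega>"
    using assms(4,5) test_functions_support[OF f] by (auto simp: L_def intro: compact_Un)
  have conv: "test_converges L (\<lambda>n x. \<psi> n x - f x) (\<lambda>x. \<phi> x - f x)"
    unfolding L_def using test_functions_support[OF f] assms(3,4)
    by (intro test_converges_diff) (auto intro: compact_imp_closed)
  obtain g where g: "g \<in> W" "\<phi> = (\<lambda>x. f x + g x)" using Basis(2) V by blast
  then have "(\<lambda>x. \<phi> x - f x) = g" by auto
  then have "(\<lambda>x. \<phi> x - f x) \<in> W \<inter> test_functions_on L"
    using g(1) conv by (simp add: test_converges_def)
  from test_converges_eventually_on[OF W[OF L] this conv L(1)]
  show ?case
  proof eventually_elim
    case (elim n)
    then show ?case unfolding V by (intro image_eqI[of _ _ "\<lambda>x. \<psi> n x - f x"]) auto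
  qed
qed simp

lemma distribution_tendsto:
  assumes "u \<in> distributions \<Omega>" "test_converges K \<psi> \<phi>" "compact K" "K \<subseteq> \<Omega>"
  shows "(\<lambda>n. u (\<psi> n)) \<longlonglongrightarrow> u \<phi>"
proof (rule topological_tendstoI)
  fix S assume S: "open S" "u \<phi> \<in> S"
  let ?V = "{f \<in> topspace (test_topology \<Omega>). u f \<in> S}"
  have "openin (test_topology \<Omega>) ?V"
    using assms(1) S(1) unfolding distributions_def continuous_map_def by auto
  moreover have "\<phi> \<in> ?V"
    using assms(2) S(2) test_functions_on_subset[OF assms(3,4)]
    by (auto simp: topspace_test_topology test_converges_def)
  ultimately have "\<forall>\<^sub>F n in sequentially. \<psi> n \<in> ?V"
    using test_converges_eventually assms(2-4) by blast
  then show "\<forall>\<^sub>F n in sequentially. u (\<psi> n) \<in> S" by eventually_elim blast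
qed

lemma distribution_linear:
  assumes "u \<in> distributions \<Omega>" "compact K" "K \<subseteq> \<Omega>"
  shows "linear_functional_on (test_functions_on K) u"
  using assms(1) test_functions_on_subset[OF assms(2,3)]
  by (auto simp: linear_functional_on_def distributions_def subset_iff)

lemma linear_functional_on_sum:
  assumes "linear_functional_on (test_functions_on K) u" "closed K" "finite A"
    and "\<And>a. a \<in> A \<Longrightarrow> f a \<in> test_functions_on K"
  shows "u (\<lambda>x. \<Sum>a\<in>A. f a x) = (\<Sum>a\<in>A. u (f a))"
  using assms(3,4)
proof (induction A rule: finite_induct)
  case empty
  have "(\<lambda>_. 0) \<in> test_functions_on K"
    using assms(2) by (simp add: test_functions_on_iff smooth_const)
  then have "u (\<lambda>x. 0 * 0) = 0 * u (\<lambda>_. 0)"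
    by (rule linear_functional_onD(2)[OF assms(1)])
  then show ?case by simp
next
  case (insert a A)
  then have "u (\<lambda>x. f a x + (\<Sum>a\<in>A. f a x)) = u (f a) + u (\<lambda>x. \<Sum>a\<in>A. f a x)"
    using assms(2) by (intro linear_functional_onD(1)[OF assms(1)] test_functions_on_sum) auto
  then show ?case using insert by simp
qed

text \<open>For a fixed word \<open>w\<close> the bound \<open>b k\<close> holds from
  \<open>k = length w\<close> on, which is enough for the Weierstrass test. The sums
  \<open>F w\<close> of the differentiated series form a class closed under partial derivatives,
  which gives smoothness.\<close>

lemma test_series_converges:
  fixes f :: "nat \<Rightarrow> real^'n::finite \<Rightarrow> complex"
  assumes f: "\<And>k. f k \<in> test_functions_on K" and K: "compact K" and b: "summable b"
    and le: "\<And>w k x. length w \<le> k \<Longrightarrow> norm (wderiv w (f k) x) \<le> b k"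
  shows "\<exists>\<phi>. test_converges K (\<lambda>n x. \<Sum>k<n. f k x) \<phi>"
proof -
  note cl = compact_imp_closed[OF K] and sm = test_functions_on_smooth[OF f]
  define F where "F w x = (\<Sum>k. wderiv w (f k) x)" for w x
  have lim: "uniform_limit UNIV (\<lambda>n x. \<Sum>k<n. wderiv w (f k) x) (F w) sequentially" for w
    unfolding F_def
  proof (rule Weierstrass_m_test_ev[OF _ b])
    show "\<forall>\<^sub>F k in sequentially. \<forall>x\<in>UNIV. norm (wderiv w (f k) x) \<le> b k"
      using eventually_ge_at_top[of "length w"] by eventually_elim (simp add: le)
  qed
  have sums: "(\<lambda>k. wderiv w (f k) x) sums F w x" for w x
    using tendsto_uniform_limitI[OF lim, of x w] by (simp add: sums_def)
  have cont: "continuous_on UNIV (F w)" for w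
    by (rule uniform_limit_theorem[OF _ lim])
       (auto intro!: always_eventually smooth_continuous smooth_sum smooth_wderiv sm)
  have pd: "has_pd i (F w) (F (i # w))" for i w
    unfolding has_pd_def
  proof
    fix x :: "real^'n"
    let ?l = "\<lambda>t. x + t *\<^sub>R axis i 1"
    \<comment> \<open>Termwise differentiation on the line through \<open>x\<close> in direction
      \<open>i\<close>; the differentiated series converges uniformly by \<open>lim\<close> for the
      longer word \<open>i # w\<close>.\<close>
    have "\<exists>g. \<forall>t\<in>UNIV. (\<lambda>k. wderiv w (f k) (?l t)) sums g t \<and>
      (g has_derivative (\<lambda>h. h *\<^sub>R F (i # w) (?l t))) (at t within UNIV)"
    proof (rule has_derivative_series[where f' = "\<lambda>k t h. h *\<^sub>R wderiv (i # w) (f k) (?l t)" and x = 0])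
      fix k t
      show "((\<lambda>t. wderiv w (f k) (?l t)) has_derivative (\<lambda>h. h *\<^sub>R wderiv (i # w) (f k) (?l t))) (at t within UNIV)"
        using has_pd_at[OF smooth_has_pd[OF smooth_wderiv[OF sm]], of w k x i t]
        by (simp add: has_vector_derivative_def)
    next
      fix e :: real assume "e > 0"
      then have "\<forall>\<^sub>F n in sequentially. \<forall>x\<in>UNIV. dist (\<Sum>k<n. wderiv (i # w) (f k) x) (F (i # w) x) < e"
        using lim[of "i # w"] unfolding uniform_limit_iff by blast
      then show "\<forall>\<^sub>F n in sequentially. \<forall>t\<in>UNIV. \<forall>h. norm ((\<Sum>k<n. h *\<^sub>R wderiv (i # w) (f k) (?l t)) - h *\<^sub>R F (i # w) (?l t)) \<le> e * norm h"
      proof eventually_elim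
        case (elim n)
        show ?case
        proof (intro ballI allI)
          fix t h :: real
          have "norm ((\<Sum>k<n. wderiv (i # w) (f k) (?l t)) - F (i # w) (?l t)) \<le> e"
            using elim by (simp add: dist_norm less_imp_le)
          then have "\<bar>h\<bar> * norm ((\<Sum>k<n. wderiv (i # w) (f k) (?l t)) - F (i # w) (?l t)) \<le> \<bar>h\<bar> * e"
            by (rule mult_left_mono) simp
          then show "norm ((\<Sum>k<n. h *\<^sub>R wderiv (i # w) (f k) (?l t)) - h *\<^sub>R F (i # w) (?l t)) \<le> e * norm h"
            by (simp only: scaleR_sum_right[symmetric] scaleR_diff_right[symmetric] norm_scaleR real_norm_def mult.commute[of e])
        qed
      qed
    qed (use sums in auto)
    then obtain g where g: "\<And>t. (\<lambda>k. wderiv w (f k) (?l t)) sums g t"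
      "\<And>t. (g has_derivative (\<lambda>h. h *\<^sub>R F (i # w) (?l t))) (at t)" by auto
    have "g = (\<lambda>t. F w (?l t))"
      using sums_unique2[OF g(1) sums] by blast
    then show "((\<lambda>t. F w (?l t)) has_vector_derivative F (i # w) x) (at 0)"
      using g(2)[of 0] by (simp add: has_vector_derivative_def)
  qed
  have "smooth (F [])"
  proof (rule smooth_coinduct[where P = "\<lambda>h. \<exists>w. h = F w"])
    show "\<exists>w. F [] = F w" by blast
    show "\<And>h. \<exists>w. h = F w \<Longrightarrow> continuous_on UNIV h" using cont by blast
    show "\<And>h i. \<exists>w. h = F w \<Longrightarrow> \<exists>g. has_pd i h g \<and> ((\<exists>w. g = F w) \<or> smooth g)" using pd by blast
  qed
  moreover have "F [] x = 0" if "x \<notin> K" for x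
    using f that by (simp add: F_def test_functions_on_iff[OF cl])
  moreover have F: "wderiv w (F []) = F w" for w
    by (induction w) (simp_all add: has_pd_partial[OF pd])
  moreover have "(\<lambda>x. \<Sum>k<n. f k x) \<in> test_functions_on K" for n
    by (intro test_functions_on_sum f cl)
  moreover have "uniform_limit UNIV (\<lambda>n. wderiv w (\<lambda>x. \<Sum>k<n. f k x)) (F w) sequentially" for w
    using lim[of w] by (simp add: wderiv_sum sm)
  ultimately show ?thesis
    by (intro exI[of _ "F []"]) (simp add: test_converges_def test_functions_on_iff[OF cl])
qed

section \<open>Zeros of power series and the uniform order\<close>

lemma fsigma_ball: "fsigma (ball (a::'a::euclidean_space) r)"
proof -
  have "ball a r = (\<Union>n::nat. cball a (r - inverse (real (Suc n))))"
  proof (rule equalityI; rule subsetI)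
    fix x assume "x \<in> ball a r"
    then obtain n where "inverse (real (Suc n)) < r - dist a x"
      using reals_Archimedean[of "r - dist a x"] by auto
    then have "x \<in> cball a (r - inverse (real (Suc n)))" by simp
    then show "x \<in> (\<Union>n::nat. cball a (r - inverse (real (Suc n))))" by blast
  next
    fix x assume "x \<in> (\<Union>n::nat. cball a (r - inverse (real (Suc n))))"
    then obtain n where "dist a x \<le> r - inverse (real (Suc n))" by auto
    moreover have "inverse (real (Suc n)) > 0" by simp
    ultimately have "dist a x < r" by linarith
    then show "x \<in> ball a r" by simp
  qed
  then show ?thesis by (metis closed_cball fsigma.intros)
qed

text \<open>A nonzero coefficient prevents the sum from being constant after multiplication by
  \<open>z\<close>, and a nonconstant holomorphic function on the disc has only countably many
  zeros.\<close>

lemma power_series_countable_zeros: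
  fixes a :: "nat \<Rightarrow> complex"
  assumes sums: "\<And>z. z \<in> ball 0 1 \<Longrightarrow> (\<lambda>k. a k * z ^ k) sums F z" and nz: "a m \<noteq> 0"
  shows "countable {z \<in> ball 0 1. F z = 0}"
proof -
  \<comment> \<open>The shifted coefficients are those of \<open>z * F z\<close>. This vanishes at 0
    and has its nonzero coefficient at the positive index \<open>Suc m\<close>, as
    \<open>powser_0_nonzero\<close> requires.\<close>
  define b where "b n = (case n of 0 \<Rightarrow> 0 | Suc k \<Rightarrow> a k)" for n
  have b: "(\<lambda>n. b n * (z - 0) ^ n) sums (z * F z)" if "norm (z - 0) < 1" for z
  proof -
    have "(\<lambda>k. z * (a k * z ^ k)) sums (z * F z)" using that by (intro sums_mult sums) simp
    then have "(\<lambda>n. b (Suc n) * (z - 0) ^ Suc n) sums (z * F z)"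
      by (simp add: b_def mult.left_commute)
    then show ?thesis by (subst (asm) sums_Suc_iff) (simp add: b_def)
  qed
  have hol: "(\<lambda>z. z * F z) holomorphic_on ball 0 1"
    by (rule power_series_holomorphic) (use b in auto)
  obtain s where s: "s > 0" "\<And>z. z \<in> cball 0 s - {0} \<Longrightarrow> z * F z \<noteq> 0"
    by (rule powser_0_nonzero[of 1 0 b "\<lambda>z. z * F z" "Suc m"]) (use b nz in \<open>auto simp: b_def\<close>)
  have "\<not> (\<lambda>z. z * F z) constant_on ball 0 1"
  proof
    assume "(\<lambda>z. z * F z) constant_on ball 0 1"
    then have "z * F z = 0 * F 0" if "z \<in> ball 0 1" for z
      using that unfolding constant_on_def by (metis centre_in_ball zero_less_one)
    \<comment> \<open>A point of the unit disc inside the punctured disc without zeros; it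
      contradicts that the constant value is the one at 0, namely 0.\<close>
    moreover have "of_real (min s (1/2)) \<in> ball (0::complex) 1" "of_real (min s (1/2)) \<in> cball (0::complex) s - {0}"
      using s(1) by auto
    ultimately show False using s(2) by fastforce
  qed
  then have "countable {z \<in> ball 0 1. z * F z = 0}"
    by (intro holomorphic_countable_zeros[OF hol]) (auto simp: fsigma_ball)
  then show ?thesis by (rule countable_subset[rotated]) auto
qed

text \<open>If no order \<open>m\<close> works for all test functions on \<open>K\<close>, there are counterexamples \<open>f m\<close> to each
  order. With small \<open>e k > 0\<close>, all \<open>\<Sum>k. z ^ k * e k * f k\<close> with \<open>norm z < 1\<close> are test functions, on which
  the relevant \<open>m\<close>-th derivative of \<open>u\<close> is a power series in \<open>z\<close> with nonzero \<open>m\<close>-th coefficient.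
  Avoiding the countably many zeros of all these series gives a test function for which no order works.\<close>

lemma uniform_order:
  fixes \<Omega> :: "(real^'n::finite) set"
  assumes u: "u \<in> distributions \<Omega>" and K: "compact K" "K \<subseteq> \<Omega>"
    and hyp: "\<forall>\<phi>\<in>test_functions \<Omega>. \<exists>m::nat. \<forall>\<alpha>::'n \<Rightarrow> nat. mi_order \<alpha> = m \<longrightarrow> distr_D \<alpha> u \<phi> = 0"
  shows "\<exists>m. \<forall>i. \<forall>\<psi>\<in>test_functions_on K. u (wderiv (replicate m i) \<psi>) = 0"
proof (rule ccontr)
  assume "\<not> ?thesis"
  then obtain i f where f: "\<And>m. f m \<in> test_functions_on K"
    and nz: "\<And>m. u (wderiv (replicate m (i m)) (f m)) \<noteq> 0"
    by metis
  note cl = compact_imp_closed[OF K(1)] and sm = test_functions_on_smooth[OF f]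
  define L where "L m \<phi> = u (wderiv (replicate m (i m)) \<phi>)" for m \<phi>
  \<comment> \<open>There are only finitely many words of length at most \<open>k\<close>, so one
    factor brings all these derivatives of \<open>f k\<close> below 1. The terms with factor
    \<open>z ^ k\<close> then obey the bound of \<open>test_series_converges\<close> with
    \<open>b k = norm z ^ k\<close>.\<close>
  have "\<exists>e>0. \<forall>w x. length w \<le> k \<longrightarrow> e * norm (wderiv w (f k) x) \<le> 1" for k
  proof -
    let ?W = "{w :: 'n list. set w \<subseteq> UNIV \<and> length w \<le> k}"
    have fin: "finite ?W" by (rule finite_lists_length_le) simp
    have "\<exists>B>0. \<forall>x. norm (wderiv w (f k) x) \<le> B" for w
      using test_functions_on_bounded[OF test_functions_on_wderiv[OF f cl] K(1)] by metis
    then obtain B where B: "\<And>w. B w > 0" "\<And>w x. norm (wderiv w (f k) x) \<le> B w" by metis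
    have "norm (wderiv w (f k) x) \<le> 1 + sum B ?W" if "length w \<le> k" for w x
      using B(2)[of w x] member_le_sum[of w ?W B] fin that B(1) by (fastforce simp: less_imp_le)
    moreover have "1 + sum B ?W > 0" using B(1) by (intro add_pos_nonneg sum_nonneg) (auto simp: less_imp_le)
    ultimately show ?thesis
      by (intro exI[of _ "inverse (1 + sum B ?W)"]) (auto simp: field_simps)
  qed
  then obtain e where e: "\<And>k. e k > 0" "\<And>k w x. length w \<le> k \<Longrightarrow> e k * norm (wderiv w (f k) x) \<le> 1"
    by metis
  define g where "g z k x = (of_real (e k) * z ^ k) * f k x" for z k x
  have g: "g z k \<in> test_functions_on K" for z k
    unfolding g_def[abs_def] by (intro test_functions_on_mult smooth_const f cl)
  have "\<exists>\<phi>. test_converges K (\<lambda>n x. \<Sum>k<n. g z k x) \<phi>" if "z \<in> ball 0 1" for z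
  proof (rule test_series_converges[OF g K(1)])
    show "summable (\<lambda>k. norm z ^ k)" using that by (intro summable_geometric) simp
    fix w :: "'n list" and k x assume "length w \<le> k"
    then have "e k * norm (wderiv w (f k) x) * norm z ^ k \<le> 1 * norm z ^ k"
      by (intro mult_right_mono e) simp_all
    then show "norm (wderiv w (g z k) x) \<le> norm z ^ k"
      using e(1)[of k] unfolding g_def[abs_def] wderiv_cmult[OF sm]
      by (simp add: norm_mult norm_power mult_ac)
  qed
  then obtain \<Phi> where \<Phi>: "\<And>z. z \<in> ball 0 1 \<Longrightarrow> test_converges K (\<lambda>n x. \<Sum>k<n. g z k x) (\<Phi> z)"
    by metis
  have L: "(\<lambda>k. (of_real (e k) * L m (f k)) * z ^ k) sums L m (\<Phi> z)" if "z \<in> ball 0 1" for m z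
  proof -
    have "(\<lambda>n. L m (\<lambda>x. \<Sum>k<n. g z k x)) \<longlonglongrightarrow> L m (\<Phi> z)"
      unfolding L_def by (rule distribution_tendsto[OF u test_converges_wderiv[OF \<Phi>[OF that] cl] K])
    moreover have "L m (\<lambda>x. \<Sum>k<n. g z k x) = (\<Sum>k<n. (of_real (e k) * L m (f k)) * z ^ k)" for n
    proof -
      have "L m (\<lambda>x. \<Sum>k<n. g z k x) = u (\<lambda>x. \<Sum>k<n. wderiv (replicate m (i m)) (g z k) x)"
        unfolding L_def by (subst wderiv_sum) (auto intro: test_functions_on_smooth[OF g])
      also have "\<dots> = (\<Sum>k<n. u (wderiv (replicate m (i m)) (g z k)))"
        by (intro linear_functional_on_sum[OF distribution_linear[OF u K] cl] test_functions_on_wderiv[OF g cl]) simp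
      also have "\<dots> = (\<Sum>k<n. (of_real (e k) * L m (f k)) * z ^ k)"
        unfolding g_def[abs_def] L_def wderiv_cmult[OF sm]
          linear_functional_onD(2)[OF distribution_linear[OF u K] test_functions_on_wderiv[OF f cl]]
        by (simp add: mult_ac)
      finally show ?thesis .
    qed
    ultimately show ?thesis by (simp add: sums_def)
  qed
  have "countable {z \<in> ball 0 1. L m (\<Phi> z) = 0}" for m
    using nz[of m] e(1)[of m] by (intro power_series_countable_zeros[OF L, of m m]) (auto simp: L_def)
  then have "countable (\<Union>m. {z \<in> ball 0 1. L m (\<Phi> z) = 0})" by simp
  moreover have "uncountable (ball (0::complex) 1)" by (rule uncountable_ball) simp
  ultimately have "\<not> ball 0 1 \<subseteq> (\<Union>m. {z \<in> ball 0 1. L m (\<Phi> z) = 0})"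
    by (meson countable_subset)
  then have "\<exists>z. z \<in> ball 0 1 \<and> (\<forall>m. L m (\<Phi> z) \<noteq> 0)" by auto
  then obtain z where z: "z \<in> ball 0 1" "\<And>m. L m (\<Phi> z) \<noteq> 0" by blast
  have "\<Phi> z \<in> test_functions_on K"
    using \<Phi>[OF z(1)] unfolding test_converges_def by blast
  then have "\<Phi> z \<in> test_functions \<Omega>" by (rule subsetD[OF test_functions_on_subset[OF K]])
  then obtain m where m: "\<And>\<alpha>::'n \<Rightarrow> nat. mi_order \<alpha> = m \<Longrightarrow> distr_D \<alpha> u (\<Phi> z) = 0" using hyp by blast
  \<comment> \<open>The failing derivative is pure, in a coordinate \<open>i m\<close> that may vary
    with \<open>m\<close>; it is one of the multi-indices of order \<open>m\<close> covered by the
    hypothesis.\<close>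
  have "mi_order (\<lambda>j. if j = i m then m else 0) = m" by (simp add: mi_order_def)
  from m[OF this] have "L m (\<Phi> z) = 0"
    by (simp add: distr_D_def mderiv_single funpow_partial_deriv L_def)
  then show False using z(2) by blast
qed

section \<open>From local to global\<close>

lemma complex_polynomial_line:
  assumes "complex_polynomial p"
  shows "\<exists>q. \<forall>t. p (x + t *\<^sub>R v) = poly q (of_real t)"
proof -
  obtain A c where p: "p = polynomial_of A c"
    using assms by (auto simp: complex_polynomial_iff)
  show ?thesis
    by (intro exI[of _ "\<Sum>\<beta>\<in>A. smult (c \<beta>) (\<Prod>i\<in>UNIV. [:of_real (x $ i), of_real (v $ i):] ^ \<beta> i)"])
       (simp add: p polynomial_of_def monomial_def poly_sum poly_prod)
qed

lemma complex_polynomial_smooth: "complex_polynomial p \<Longrightarrow> smooth p"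
  by (auto simp: complex_polynomial_iff smooth_polynomial_of)

text \<open>On the line from \<open>y\<close> to \<open>x\<close> both become polynomials in one
  variable. They agree for all small parameters, hence have infinitely many common values and
  coincide; parameter 1 is the point \<open>x\<close>.\<close>

lemma complex_polynomial_identity:
  fixes p q :: "real^'n::finite \<Rightarrow> complex"
  assumes "complex_polynomial p" "complex_polynomial q" "open U" "y \<in> U" "\<And>x. x \<in> U \<Longrightarrow> p x = q x"
  shows "p = q"
proof
  fix x
  obtain P where P: "\<And>t. p (y + t *\<^sub>R (x - y)) = poly P (of_real t)"
    using complex_polynomial_line[OF assms(1), of y "x - y"] by blast
  obtain Q where Q: "\<And>t. q (y + t *\<^sub>R (x - y)) = poly Q (of_real t)"
    using complex_polynomial_line[OF assms(2), of y "x - y"] by blast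
  let ?V = "(\<lambda>t::real. y + t *\<^sub>R (x - y)) -` U"
  have "continuous_on UNIV (\<lambda>t::real. y + t *\<^sub>R (x - y))"
    by (intro continuous_on_add continuous_on_scaleR continuous_on_const continuous_on_id)
  then have "open ?V" using assms(3) open_vimage by blast
  moreover have "0 \<in> ?V" using assms(4) by simp
  ultimately obtain \<delta> where \<delta>: "\<delta> > 0" "ball 0 \<delta> \<subseteq> ?V"
    by (meson open_contains_ball)
  have "poly (P - Q) z = 0" if "z \<in> of_real ` {0<..<\<delta>}" for z :: complex
  proof -
    from that obtain t where t: "z = of_real t" "t \<in> {0<..<\<delta>}" by (rule imageE)
    then have "t \<in> ?V" using \<delta>(2) by (auto simp: subset_iff)
    then show ?thesis using assms(5) P[of t] Q[of t] t(1) by simp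
  qed
  then have "of_real ` {0<..<\<delta>} \<subseteq> {z :: complex. poly (P - Q) z = 0}" by blast
  moreover have "infinite (complex_of_real ` {0<..<\<delta>})"
    using \<delta>(1) by (simp add: finite_image_iff inj_on_def infinite_Ioo)
  ultimately have "P - Q = 0" using poly_roots_finite[of "P - Q"] finite_subset by blast
  then show "p x = q x" using P[of 1] Q[of 1] by simp
qed

text \<open>Testing against the conjugate of \<open>f\<close> times the product bump gives integral
  0 for the nonnegative continuous function |f|^2 times bump, and the bump is positive inside the
  box.\<close>

lemma smooth_integral_zero_on_box:
  fixes f :: "real^'n::finite \<Rightarrow> complex"
  assumes f: "smooth f"
    and 0: "\<And>\<phi>. \<phi> \<in> test_functions_on (cbox l r) \<Longrightarrow> (LINT x|lborel. f x * \<phi> x) = 0"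
    and x: "x \<in> box l r"
  shows "f x = 0"
proof -
  let ?b = "\<lambda>x. complex_of_real (box_bump l r x)"
  let ?h = "\<lambda>x. (norm (f x))\<^sup>2 * box_bump l r x"
  have "?b \<in> test_functions_on (cbox l r)"
    using smooth_box_bump box_bump_0 box_subset_cbox by (fastforce simp: test_functions_on_iff closed_cbox)
  then have \<phi>: "(\<lambda>x. cnj (f x) * ?b x) \<in> test_functions_on (cbox l r)"
    by (rule test_functions_on_mult[OF smooth_cnj[OF f] _ closed_cbox])
  then have \<psi>: "(\<lambda>x. f x * (cnj (f x) * ?b x)) \<in> test_functions_on (cbox l r)"
    by (rule test_functions_on_mult[OF f _ closed_cbox])
  have eq: "f x * (cnj (f x) * ?b x) = of_real (?h x)" for x
    by (simp add: mult.assoc[symmetric] complex_norm_square[symmetric])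
  have "integrable lborel (\<lambda>x. complex_of_real (?h x))"
    using test_functions_on_integrable[OF \<psi> compact_cbox] unfolding eq .
  then have int: "integrable lborel ?h"
    by (simp only: complex_of_real_integrable_eq)
  have "(LINT x|lborel. complex_of_real (?h x)) = 0"
    using 0[OF \<phi>] unfolding eq .
  then have int0: "(LINT x|lborel. ?h x) = 0"
    by (simp only: integral_complex_of_real of_real_eq_0_iff)
  have "continuous_on UNIV (\<lambda>x. Re (complex_of_real (?h x)))"
    using continuous_on_Re[OF smooth_continuous[OF test_functions_on_smooth[OF \<psi>], of UNIV]] unfolding eq .
  then have "continuous_on UNIV ?h" by (simp only: Re_complex_of_real)
  then have "?h x = 0"
    by (rule continuous_nonneg_integral_0[OF _ _ int int0]) (simp add: box_bump_nonneg)
  then show ?thesis using box_bump_pos[OF x] by simp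
qed

lemma polynomial_unique_on_box:
  fixes p q :: "real^'n::finite \<Rightarrow> complex"
  assumes p: "complex_polynomial p" and q: "complex_polynomial q"
    and eq: "\<And>\<phi>. \<phi> \<in> test_functions_on (cbox l r) \<Longrightarrow> (LINT x|lborel. p x * \<phi> x) = (LINT x|lborel. q x * \<phi> x)"
    and y: "y \<in> box l r"
  shows "p = q"
proof (rule complex_polynomial_identity[OF p q open_box y])
  fix x assume x: "x \<in> box l r"
  note sm = complex_polynomial_smooth[OF p] complex_polynomial_smooth[OF q]
  have "(LINT x|lborel. (p x - q x) * \<phi> x) = 0" if \<phi>: "\<phi> \<in> test_functions_on (cbox l r)" for \<phi>
  proof -
    have "integrable lborel (\<lambda>x. f x * \<phi> x)" if "smooth f" for f
      by (rule test_functions_on_integrable[OF test_functions_on_mult[OF that \<phi> closed_cbox] compact_cbox])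
    from this[OF sm(1)] this[OF sm(2)] show ?thesis using eq[OF \<phi>] by (simp add: left_diff_distrib)
  qed
  from smooth_integral_zero_on_box[OF smooth_diff[OF sm] this x]
  show "p x = q x" by simp
qed

lemma cube_in_open:
  fixes x :: "real^'n::finite"
  assumes "open S" "x \<in> S"
  shows "\<exists>d>0. cbox (\<chi> i. x $ i - d) (\<chi> i. x $ i + d) \<subseteq> S"
proof -
  obtain e where e: "e > 0" "cball x e \<subseteq> S" using assms open_contains_cball by blast
  \<comment> \<open>The Euclidean norm is at most the sum of the absolute coordinates, so dividing
    \<open>e\<close> by the dimension keeps the cube in the ball.\<close>
  define d where "d = e / real CARD('n)"
  have "cbox (\<chi> i. x $ i - d) (\<chi> i. x $ i + d) \<subseteq> cball x e"
  proof
    fix y assume y: "y \<in> cbox (\<chi> i. x $ i - d) (\<chi> i. x $ i + d)"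
    have "\<bar>(x - y) $ i\<bar> \<le> d" for i
    proof -
      have "x $ i - d \<le> y $ i \<and> y $ i \<le> x $ i + d" using y by (simp add: mem_box_cart)
      then show ?thesis by (auto simp: abs_le_iff)
    qed
    then have "(\<Sum>i\<in>UNIV. \<bar>(x - y) $ i\<bar>) \<le> real CARD('n) * d"
      using sum_bounded_above[of UNIV "\<lambda>i. \<bar>(x - y) $ i\<bar>" d] by simp
    then have "norm (x - y) \<le> e"
      using norm_le_l1_cart[of "x - y"] by (simp add: d_def)
    then show "y \<in> cball x e" by (simp add: dist_norm)
  qed
  moreover have "d > 0" using e(1) by (simp add: d_def)
  ultimately show ?thesis using e(2) by blast
qed

lemma mem_box_cube: "d > 0 \<Longrightarrow> (x :: real^'n::finite) \<in> box (\<chi> i. x $ i - d) (\<chi> i. x $ i + d)"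
  by (simp add: mem_box_cart)

definition represented_on :: "((real^'n::finite \<Rightarrow> complex) \<Rightarrow> complex) \<Rightarrow> (real^'n) set \<Rightarrow> (real^'n \<Rightarrow> complex) \<Rightarrow> bool" where
  "represented_on u K p \<longleftrightarrow> (\<forall>\<phi>\<in>test_functions_on K. u \<phi> = (LINT x|lborel. p x * \<phi> x))"

lemma global_polynomial:
  fixes \<Omega> :: "(real^'n::finite) set"
  assumes \<Omega>: "open \<Omega>" "connected \<Omega>" "\<Omega> \<noteq> {}"
    and loc: "\<And>l r. (\<And>i. l $ i < r $ i) \<Longrightarrow> cbox l r \<subseteq> \<Omega> \<Longrightarrow> \<exists>p. complex_polynomial p \<and> represented_on u (cbox l r) p"
  shows "\<exists>p. complex_polynomial p \<and>
    (\<forall>x\<in>\<Omega>. \<exists>l r. x \<in> box l r \<and> cbox l r \<subseteq> \<Omega> \<and> represented_on u (cbox l r) p)"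
proof -
  \<comment> \<open>With the predicate \<open>R\<close> as a parameter, one openness proof serves
    both \<open>p = p0\<close> and \<open>p \<noteq> p0\<close>. Membership in the open box makes
    \<open>G R\<close> open, while the closed box carries compactly supported test
    functions.\<close>
  define G where "G R = {x. \<exists>l r p. x \<in> box l r \<and> cbox l r \<subseteq> \<Omega> \<and> complex_polynomial p \<and> R p \<and> represented_on u (cbox l r) p}"
    for R :: "(real^'n \<Rightarrow> complex) \<Rightarrow> bool"
  have G_open: "open (G R)" for R
  proof (subst open_subopen, intro ballI)
    fix x assume "x \<in> G R"
    then obtain l r p where "x \<in> box l r" "cbox l r \<subseteq> \<Omega>" "complex_polynomial p" "R p" "represented_on u (cbox l r) p"
      unfolding G_def by blast
    then show "\<exists>T. open T \<and> x \<in> T \<and> T \<subseteq> G R"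
      unfolding G_def by (intro exI[of _ "box l r"]) (auto simp: open_box)
  qed
  have cube: "\<exists>l r p. x \<in> box l r \<and> cbox l r \<subseteq> \<Omega> \<and> complex_polynomial p \<and> represented_on u (cbox l r) p"
    if x: "x \<in> \<Omega>" for x
  proof -
    obtain d where d: "d > 0" "cbox (\<chi> i. x $ i - d) (\<chi> i. x $ i + d) \<subseteq> \<Omega>"
      using cube_in_open[OF \<Omega>(1) x] by blast
    then obtain p where "complex_polynomial p" "represented_on u (cbox (\<chi> i. x $ i - d) (\<chi> i. x $ i + d)) p"
      using loc[OF _ d(2)] by auto
    then show ?thesis using mem_box_cube[OF d(1)] d(2) by blast
  qed
  obtain x0 where x0: "x0 \<in> \<Omega>" using \<Omega>(3) by blast
  then obtain p0 where p0: "complex_polynomial p0" "x0 \<in> G (\<lambda>p. p = p0)"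
    using cube[OF x0] unfolding G_def by blast
  have cover: "\<Omega> \<subseteq> G (\<lambda>p. p = p0) \<union> G (\<lambda>p. p \<noteq> p0)"
  proof
    fix x assume "x \<in> \<Omega>"
    then obtain l r p where "x \<in> box l r" "cbox l r \<subseteq> \<Omega>" "complex_polynomial p" "represented_on u (cbox l r) p"
      using cube by blast
    then show "x \<in> G (\<lambda>p. p = p0) \<union> G (\<lambda>p. p \<noteq> p0)"
      unfolding G_def by (cases "p = p0") blast+
  qed
  have disj: "G (\<lambda>p. p = p0) \<inter> G (\<lambda>p. p \<noteq> p0) \<inter> \<Omega> = {}"
  proof (rule ccontr)
    assume "\<not> ?thesis"
    then obtain x where x: "x \<in> G (\<lambda>p. p = p0)" "x \<in> G (\<lambda>p. p \<noteq> p0)" by blast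
    from x(1) obtain l r where 1: "x \<in> box l r" "represented_on u (cbox l r) p0"
      unfolding G_def by blast
    from x(2) obtain l' r' p where 2: "x \<in> box l' r'" "represented_on u (cbox l' r') p" "complex_polynomial p" "p \<noteq> p0"
      unfolding G_def by blast
    \<comment> \<open>Two representing polynomials are compared on a cube inside both boxes, where
      they act alike on test functions and hence are equal.\<close>
    obtain d where d: "d > 0" "cbox (\<chi> i. x $ i - d) (\<chi> i. x $ i + d) \<subseteq> box l r \<inter> box l' r'"
      using cube_in_open[of "box l r \<inter> box l' r'" x] 1 2 by (auto simp: open_box open_Int)
    have "p = p0"
    proof (rule polynomial_unique_on_box[OF 2(3) p0(1) _ mem_box_cube[OF d(1)]])
      fix \<phi> assume \<phi>: "\<phi> \<in> test_functions_on (cbox (\<chi> i. x $ i - d) (\<chi> i. x $ i + d))"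
      have "\<phi> \<in> test_functions_on (cbox l r)" "\<phi> \<in> test_functions_on (cbox l' r')"
        using d(2) box_subset_cbox[of l r] box_subset_cbox[of l' r']
        by (auto intro!: test_functions_on_mono[OF \<phi>])
      then show "(LINT x|lborel. p x * \<phi> x) = (LINT x|lborel. p0 x * \<phi> x)"
        using 1(2) 2(2) unfolding represented_on_def by metis
    qed
    then show False using 2(4) by blast
  qed
  have "G (\<lambda>p. p = p0) \<inter> \<Omega> = {} \<or> G (\<lambda>p. p \<noteq> p0) \<inter> \<Omega> = {}"
    by (rule connectedD[OF \<Omega>(2) G_open G_open disj cover])
  then have "\<Omega> \<subseteq> G (\<lambda>p. p = p0)" using cover x0 p0(2) by blast
  then have "\<exists>l r. x \<in> box l r \<and> cbox l r \<subseteq> \<Omega> \<and> represented_on u (cbox l r) p0" if "x \<in> \<Omega>" for x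
    using that unfolding G_def by blast
  then show ?thesis using p0(1) by blast
qed

section \<open>Patching the local representations\<close>

lemma support_mult_subset: "support (\<lambda>x. \<psi> x * \<phi> x) \<subseteq> support \<phi>"
  unfolding support_def by (intro closure_mono) auto

lemma test_functions_mult:
  assumes "smooth \<psi>" "\<phi> \<in> test_functions \<Omega>"
  shows "(\<lambda>x. \<psi> x * \<phi> x) \<in> test_functions \<Omega>"
  using assms support_mult_subset[of \<psi> \<phi>]
    support_subset_imp_compact[OF support_mult_subset[of \<psi> \<phi>]]
  unfolding test_functions_def by (auto simp: smooth_mult)

lemma test_functions_integrable: "\<phi> \<in> test_functions \<Omega> \<Longrightarrow> integrable lborel \<phi>"
  using test_functions_support test_functions_on_integrable by blast

lemma distributions_add: "u \<in> distributions \<Omega> \<Longrightarrow> \<phi> \<in> test_functions \<Omega> \<Longrightarrow> \<psi> \<in> test_functions \<Omega> \<Longrightarrow>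
    u (\<lambda>x. \<phi> x + \<psi> x) = u \<phi> + u \<psi>"
  by (simp add: distributions_def)

text \<open>In place of a partition of unity, \<open>\<phi>\<close> is split as \<open>\<psi> * \<phi> + (1 - \<psi>) * \<phi>\<close> for one cutoff \<open>\<psi>\<close> of the
  cover at a time; the second summand vanishes where \<open>\<psi> = 1\<close>.\<close>

lemma represented_globally:
  fixes \<Omega> :: "(real^'n::finite) set"
  assumes u: "u \<in> distributions \<Omega>" and p: "complex_polynomial p"
    and loc: "\<And>x. x \<in> \<Omega> \<Longrightarrow> \<exists>l r. x \<in> box l r \<and> cbox l r \<subseteq> \<Omega> \<and> represented_on u (cbox l r) p"
    and \<phi>: "\<phi> \<in> test_functions \<Omega>"
  shows "u \<phi> = (LINT x|lborel. p x * \<phi> x)"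
proof -
  have "\<exists>\<psi> U. smooth \<psi> \<and> open U \<and> x \<in> U \<and> (\<forall>y\<in>U. \<psi> y = 1) \<and>
      (\<forall>\<phi>\<in>test_functions \<Omega>. u (\<lambda>y. \<psi> y * \<phi> y) = (LINT y|lborel. p y * (\<psi> y * \<phi> y)))"
    if x: "x \<in> \<Omega>" for x
  proof -
    obtain l r where lr: "x \<in> box l r" "represented_on u (cbox l r) p" using loc[OF x] by blast
    obtain d where d: "d > 0" "cbox (\<chi> i. x $ i - d) (\<chi> i. x $ i + d) \<subseteq> box l r"
      using cube_in_open[OF open_box lr(1)] by blast
    \<comment> \<open>With half the side, the cutoff is 1 on the half-size cube around
      \<open>x\<close> and 0 outside the cube of half-width \<open>d\<close>, so any product with it
      is a test function on the representing box.\<close>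
    obtain \<psi> :: "real^'n \<Rightarrow> complex" where \<psi>: "smooth \<psi>"
      "\<And>y. (\<And>i. \<bar>y $ i - x $ i\<bar> < d / 2) \<Longrightarrow> \<psi> y = 1"
      "\<And>y i. \<bar>y $ i - x $ i\<bar> \<ge> 2 * (d / 2) \<Longrightarrow> \<psi> y = 0"
      using cutoff_exists[of "d / 2" x] d(1) by auto
    have out: "\<psi> y = 0" if "y \<notin> cbox l r" for y
    proof -
      have "y \<notin> cbox (\<chi> i. x $ i - d) (\<chi> i. x $ i + d)"
        using that d(2) box_subset_cbox[of l r] by blast
      then obtain i where "y $ i < x $ i - d \<or> x $ i + d < y $ i"
        by (auto simp: mem_box_cart not_le)
      then show ?thesis using d(1) by (intro \<psi>(3)[of _ i]) auto
    qed
    have "u (\<lambda>y. \<psi> y * \<phi> y) = (LINT y|lborel. p y * (\<psi> y * \<phi> y))" if "\<phi> \<in> test_functions \<Omega>" for \<phi>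
    proof -
      have "smooth \<phi>" using that by (simp add: test_functions_def)
      then have "(\<lambda>y. \<psi> y * \<phi> y) \<in> test_functions_on (cbox l r)"
        using \<psi>(1) out by (simp add: test_functions_on_iff closed_cbox smooth_mult)
      then show ?thesis using lr(2) unfolding represented_on_def by blast
    qed
    moreover have "\<psi> y = 1" if "y \<in> box (\<chi> i. x $ i - d / 2) (\<chi> i. x $ i + d / 2)" for y
    proof (rule \<psi>(2))
      fix i
      have "x $ i - d / 2 < y $ i \<and> y $ i < x $ i + d / 2" using that by (simp add: mem_box_cart)
      then show "\<bar>y $ i - x $ i\<bar> < d / 2" unfolding abs_less_iff by linarith
    qed
    moreover have "x \<in> box (\<chi> i. x $ i - d / 2) (\<chi> i. x $ i + d / 2)"
      using d(1) by (intro mem_box_cube) simp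
    ultimately show ?thesis using \<psi>(1) open_box by blast
  qed
  then have "\<forall>x\<in>\<Omega>. \<exists>\<psi> U. smooth \<psi> \<and> open U \<and> x \<in> U \<and> (\<forall>y\<in>U. \<psi> y = 1) \<and>
      (\<forall>\<phi>\<in>test_functions \<Omega>. u (\<lambda>y. \<psi> y * \<phi> y) = (LINT y|lborel. p y * (\<psi> y * \<phi> y)))"
    by blast
  from bchoice[OF this] obtain \<psi> where "\<forall>x\<in>\<Omega>. \<exists>U. smooth (\<psi> x) \<and> open U \<and> x \<in> U \<and> (\<forall>y\<in>U. \<psi> x y = 1) \<and>
      (\<forall>\<phi>\<in>test_functions \<Omega>. u (\<lambda>y. \<psi> x y * \<phi> y) = (LINT y|lborel. p y * (\<psi> x y * \<phi> y)))"
    by blast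
  from bchoice[OF this] obtain U where \<psi>: "\<And>x. x \<in> \<Omega> \<Longrightarrow> smooth (\<psi> x)" and U: "\<And>x. x \<in> \<Omega> \<Longrightarrow> open (U x)" "\<And>x. x \<in> \<Omega> \<Longrightarrow> x \<in> U x"
    and one: "\<And>x y. x \<in> \<Omega> \<Longrightarrow> y \<in> U x \<Longrightarrow> \<psi> x y = 1"
    and rep: "\<And>x \<phi>. x \<in> \<Omega> \<Longrightarrow> \<phi> \<in> test_functions \<Omega> \<Longrightarrow> u (\<lambda>y. \<psi> x y * \<phi> y) = (LINT y|lborel. p y * (\<psi> x y * \<phi> y))"
    by blast
  have claim: "u \<phi> = (LINT x|lborel. p x * \<phi> x)"
    if "finite C" "C \<subseteq> \<Omega>" "\<phi> \<in> test_functions \<Omega>" "support \<phi> \<subseteq> (\<Union>x\<in>C. U x)" for C \<phi>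
    using that
  proof (induction C arbitrary: \<phi> rule: finite_induct)
    case empty
    then have "{x. \<phi> x \<noteq> 0} = {}" unfolding support_def using closure_subset by fastforce
    then have \<phi>: "\<phi> = (\<lambda>x. 0)" by auto
    have "u (\<lambda>x. 0 * \<phi> x) = 0 * u \<phi>"
      using u empty.prems(2) unfolding distributions_def by blast
    then show ?case by (simp add: \<phi>)
  next
    case (insert x C)
    have x: "x \<in> \<Omega>" using insert.prems by blast
    define \<eta> where "\<eta> y = (1 - \<psi> x y) * \<phi> y" for y
    have sm: "smooth (\<lambda>y. 1 - \<psi> x y)" by (intro smooth_diff smooth_const \<psi> x)
    have \<eta>: "\<eta> \<in> test_functions \<Omega>"
      unfolding \<eta>_def[abs_def] by (rule test_functions_mult[OF sm insert.prems(2)])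
    have \<psi>\<phi>: "(\<lambda>y. \<psi> x y * \<phi> y) \<in> test_functions \<Omega>"
      by (rule test_functions_mult[OF \<psi>[OF x] insert.prems(2)])
    \<comment> \<open>Since \<open>U x\<close> is open, missing the nonzero set of
      \<open>\<eta>\<close> means missing its closure. The support of \<open>\<eta>\<close> is thus
      covered without \<open>U x\<close>, and the induction hypothesis applies.\<close>
    have "U x \<inter> {y. \<eta> y \<noteq> 0} = {}" using one[OF x] by (auto simp: \<eta>_def)
    then have "U x \<inter> support \<eta> = {}"
      unfolding support_def using U(1)[OF x] by (simp add: open_Int_closure_eq_empty)
    moreover have "support \<eta> \<subseteq> support \<phi>"
      unfolding \<eta>_def[abs_def] by (rule support_mult_subset)
    ultimately have "support \<eta> \<subseteq> (\<Union>x\<in>C. U x)" using insert.prems(3) by auto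
    then have 1: "u \<eta> = (LINT x|lborel. p x * \<eta> x)"
      using insert.prems(1) \<eta> by (intro insert.IH) auto
    have eq: "\<phi> = (\<lambda>y. \<psi> x y * \<phi> y + \<eta> y)" by (auto simp: \<eta>_def algebra_simps)
    have "u (\<lambda>y. \<psi> x y * \<phi> y + \<eta> y) = u (\<lambda>y. \<psi> x y * \<phi> y) + u \<eta>"
      by (rule distributions_add[OF u \<psi>\<phi> \<eta>])
    also have "\<dots> = (LINT y|lborel. p y * (\<psi> x y * \<phi> y)) + (LINT y|lborel. p y * \<eta> y)"
      using 1 rep[OF x insert.prems(2)] by simp
    also have "\<dots> = (LINT y|lborel. p y * (\<psi> x y * \<phi> y) + p y * \<eta> y)"
      by (intro Bochner_Integration.integral_add[symmetric] test_functions_integrable[of _ \<Omega>]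
          test_functions_mult complex_polynomial_smooth p \<psi>\<phi> \<eta>)
    also have "\<dots> = (LINT y|lborel. p y * \<phi> y)"
      by (simp add: \<eta>_def algebra_simps)
    finally show ?case using eq by simp
  qed
  have K: "compact (support \<phi>)" "support \<phi> \<subseteq> \<Omega>" using test_functions_support[OF \<phi>] by auto
  have cover: "support \<phi> \<subseteq> (\<Union>x\<in>\<Omega>. U x)" using K(2) U(2) by blast
  obtain C where "C \<subseteq> \<Omega>" "finite C" "support \<phi> \<subseteq> (\<Union>x\<in>C. U x)"
    by (rule compactE_image[OF K(1) U(1) cover])
  then show ?thesis using claim \<phi> by blast
qed

theorem theorem3p1:
  fixes \<Omega> :: "(real^'n::finite) set"
    and u :: "(real^'n \<Rightarrow> complex) \<Rightarrow> complex"
  assumes "open \<Omega>" and "connected \<Omega>" and "\<Omega> \<noteq> {}"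
    and "u \<in> distributions \<Omega>"
    and "\<forall>\<phi>\<in>test_functions \<Omega>. \<exists>m::nat. \<forall>\<alpha>::'n \<Rightarrow> nat. mi_order \<alpha> = m \<longrightarrow> distr_D \<alpha> u \<phi> = 0"
  shows "is_polynomial_distribution \<Omega> u"
proof -
  have "\<exists>p. complex_polynomial p \<and> represented_on u (cbox l r) p"
    if lr: "\<And>i. l $ i < r $ i" and sub: "cbox l r \<subseteq> \<Omega>" for l r
  proof -
    obtain m where m: "\<And>i \<psi>. \<psi> \<in> test_functions_on (cbox l r) \<Longrightarrow> u (wderiv (replicate m i) \<psi>) = 0"
      using uniform_order[OF assms(4) compact_cbox sub assms(5)] by blast
    obtain c where "\<And>\<phi>. \<phi> \<in> test_functions_on (cbox l r) \<Longrightarrow>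
        u \<phi> = (LINT x|lborel. polynomial_of (below (\<lambda>_. m)) c x * \<phi> x)"
      using polynomial_functional_on_box[OF lr distribution_linear[OF assms(4) compact_cbox sub] m] by blast
    then show ?thesis
      using finite_below complex_polynomial_iff unfolding represented_on_def by blast
  qed
  from global_polynomial[OF assms(1-3) this]
  obtain p where p: "complex_polynomial p"
    and loc: "\<And>x. x \<in> \<Omega> \<Longrightarrow> \<exists>l r. x \<in> box l r \<and> cbox l r \<subseteq> \<Omega> \<and> represented_on u (cbox l r) p"
    by blast
  have "u \<phi> = (LINT x:\<Omega>|lborel. p x * \<phi> x)" if \<phi>: "\<phi> \<in> test_functions \<Omega>" for \<phi>
  proof -
    have "\<phi> x = 0" if "x \<notin> \<Omega>" for x
      using test_functions_support[OF \<phi>] that closure_subset[of "{x. \<phi> x \<noteq> 0}"]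
      unfolding support_def by blast
    \<comment> \<open>The local results integrate over the whole space; as \<open>\<phi>\<close>
      vanishes off \<open>\<Omega>\<close>, this is the integral over
      \<open>\<Omega>\<close>.\<close>
    then have "indicator \<Omega> x *\<^sub>R (p x * \<phi> x) = p x * \<phi> x" for x
      by (cases "x \<in> \<Omega>") auto
    then show ?thesis
      using represented_globally[OF assms(4) p loc \<phi>] by (simp add: set_lebesgue_integral_def)
  qed
  then show ?thesis using p unfolding is_polynomial_distribution_def by blast
qed

end
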